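(* Let $v$ be a weight. Let $\varphi:[0,\infty[\to]0,\infty[$ be a continuous non-decreasing function for which there is $r_\varphi>0$ such that: $\varphi$ is of class $C^2$ on $[r_\varphi,\infty[$; $\varphi'$ is non-decreasing on $[r_\varphi,\infty[$; $\varphi'(r_\varphi)>0$; $r^n=O(\varphi'(r))$ as $r\to\infty$ for each $n\in\mathbb{N}$; and $\sup_{r\ge r_\varphi}\frac{\varphi''(r)\varphi(r)}{(\varphi'(r))^2}<\infty$. Let $w_\varphi(z):=1/\varphi(|z|)$, $z\in\mathbb{C}$ (this is a weight). The following conditions are equivalent for an entire function $g\in H(\mathbb{C})$: (1) $V_g:H^\infty_v(\mathbb{C})\to H^\infty_{w_\varphi}(\mathbb{C})$ is compact. (2) $V_g:H^0_v(\mathbb{C})\to H^0_{w_\varphi}(\mathbb{C})$ is compact. (3) $\lim_{|z|\to\infty}\frac{|g'(z)|}{\varphi'(|z|)\,\tilde v(z)}=0$. If, moreover, every discrete sequence in $\mathbb{C}$ has a subsequence that is interpolating for $H^\infty_{\tilde v}(\mathbb{C})$, then these three conditions are also equivalent to (4) $V_g:H^\infty_v(\mathbb{C})\to H^\infty_{w_\varphi}(\mathbb{C})$ is weakly compact. (5) $V_g:H^0_v(\mathbb{C})\to H^0_{w_\varphi}(\mathbb{C})$ is weakly compact.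
   Context: $H(\mathbb{C})$ is the space of entire functions. A weight is a continuous non-increasing function $v:[0,\infty[\to]0,\infty[$ with $\lim_{r\to\infty}r^mv(r)=0$ for each $m\in\mathbb{N}$; it is extended to $\mathbb{C}$ by $v(z):=v(|z|)$. For a weight $v$, $H^\infty_v(\mathbb{C})=\{f\in H(\mathbb{C}):\|f\|_v:=\sup_{z\in\mathbb{C}}v(|z|)|f(z)|<\infty\}$ and $H^0_v(\mathbb{C})=\{f\in H(\mathbb{C}):\lim_{|z|\to\infty}v(|z|)|f(z)|=0\}$, both endowed with the norm $\|\cdot\|_v$ (they are Banach spaces). The associated weight is $\tilde v(z):=\big(\sup\{|f(z)|:f\in H^\infty_v(\mathbb{C}),\ \|f\|_v\le1\}\big)^{-1}$, $z\in\mathbb{C}$; it is again a (radial) weight. For $g\in H(\mathbb{C})$ the Volterra operator is $V_g(f)(z):=\int_0^zf(\zeta)g'(\zeta)\,d\zeta$, $f\in H(\mathbb{C})$, $z\in\mathbb{C}$. Saying that an operator $T:X\to Y$ between two such spaces is compact (weakly compact) means that $T$ maps $X$ into $Y$ and is a bounded operator mapping the unit ball of $X$ to a relatively compact (relatively weakly compact) subset of $Y$. A sequence $(z_j)_j$ in $\mathbb{C}$ is called interpolating for $H^\infty_u(\mathbb{C})$ ($u$ a weight) if for every sequence $(\alpha_j)_j$ of complex numbers with $\sup_{j}u(z_j)|\alpha_j|<\infty$ there is $f\in H^\infty_u(\mathbb{C})$ with $f(z_j)=\alpha_j$ for each $j$. A discrete sequence in $\mathbb{C}$ is a sequence $(z_j)_j$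 with $|z_j|\to\infty$ (no accumulation point in $\mathbb{C}$). *)

theory Defs
  imports "HOL-Complex_Analysis.Complex_Analysis" "HOL-Library.Landau_Symbols"
begin

section \<open>Weights and weighted spaces of entire functions\<close>

text \<open>A weight lives on the half line \<open>[0, \<infinity>)\<close>; values at negative arguments are irrelevant.\<close>

definition is_weight :: "(real \<Rightarrow> real) \<Rightarrow> bool" where
  "is_weight v \<longleftrightarrow>
     continuous_on {0..} v \<and> antimono_on {0..} v \<and> (\<forall>r\<ge>0. v r > 0) \<and>
     (\<forall>m::nat. ((\<lambda>r. r ^ m * v r) \<longlongrightarrow> 0) at_top)"

text \<open>The spaces are parametrised by the weight as a function on the plane, so that they apply
  uniformly to \<open>radial v\<close>, to \<open>1 / \<phi>(|z|)\<close> and to the associated weight.\<close>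

definition radial :: "(real \<Rightarrow> real) \<Rightarrow> complex \<Rightarrow> real" where
  "radial v z = v (cmod z)"

definition Hinf :: "(complex \<Rightarrow> real) \<Rightarrow> (complex \<Rightarrow> complex) set" where
  "Hinf u = {f. f holomorphic_on UNIV \<and> bdd_above (range (\<lambda>z. u z * cmod (f z)))}"

definition H0 :: "(complex \<Rightarrow> real) \<Rightarrow> (complex \<Rightarrow> complex) set" where
  "H0 u = {f. f holomorphic_on UNIV \<and> ((\<lambda>z. u z * cmod (f z)) \<longlongrightarrow> 0) at_infinity}"

text \<open>Meaningful only on \<open>Hinf u\<close>: the supremum of an unbounded set of reals is an arbitrary value.\<close>

definition wnorm :: "(complex \<Rightarrow> real) \<Rightarrow> (complex \<Rightarrow> complex) \<Rightarrow> real" where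
  "wnorm u f = (SUP z. u z * cmod (f z))"

definition assoc_weight :: "(complex \<Rightarrow> real) \<Rightarrow> complex \<Rightarrow> real" where
  "assoc_weight u z = inverse (Sup {cmod (f z) | f. f \<in> Hinf u \<and> wnorm u f \<le> 1})"

definition interpolating :: "(complex \<Rightarrow> real) \<Rightarrow> (nat \<Rightarrow> complex) \<Rightarrow> bool" where
  "interpolating u z \<longleftrightarrow>
     (\<forall>\<alpha>::nat \<Rightarrow> complex. bdd_above (range (\<lambda>j. u (z j) * cmod (\<alpha> j))) \<longrightarrow>
        (\<exists>f \<in> Hinf u. \<forall>j. f (z j) = \<alpha> j))"

definition volterra :: "(complex \<Rightarrow> complex) \<Rightarrow> (complex \<Rightarrow> complex) \<Rightarrow> complex \<Rightarrow> complex" where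
  "volterra g f z = contour_integral (linepath 0 z) (\<lambda>\<zeta>. f \<zeta> * deriv g \<zeta>)"


section \<open>Compact and weakly compact operators between normed spaces of functions\<close>

text \<open>A normed space is given by a carrier \<open>X\<close> of functions, with pointwise operations over the
  complex scalars, and a norm \<open>p\<close>.\<close>

text \<open>The case distinction is there because \<open>Metric_space\<close> asks for nonnegativity and symmetry
  also off the carrier, where a norm such as \<open>wnorm u\<close> has arbitrary values.\<close>

definition norm_dist ::
  "(complex \<Rightarrow> complex) set \<Rightarrow> ((complex \<Rightarrow> complex) \<Rightarrow> real) \<Rightarrow>
   (complex \<Rightarrow> complex) \<Rightarrow> (complex \<Rightarrow> complex) \<Rightarrow> real" where
  "norm_dist X p f h = (if f \<in> X \<and> h \<in> X then p (\<lambda>z. f z - h z) else 0)"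

definition norm_topology ::
  "(complex \<Rightarrow> complex) set \<Rightarrow> ((complex \<Rightarrow> complex) \<Rightarrow> real) \<Rightarrow> (complex \<Rightarrow> complex) topology" where
  "norm_topology X p = Metric_space.mtopology X (norm_dist X p)"

text \<open>Functionals are total on the function type; only their restriction to \<open>X\<close> matters.\<close>

definition dual_space ::
  "(complex \<Rightarrow> complex) set \<Rightarrow> ((complex \<Rightarrow> complex) \<Rightarrow> real) \<Rightarrow> ((complex \<Rightarrow> complex) \<Rightarrow> complex) set" where
  "dual_space X p = {\<psi>.
     (\<forall>f\<in>X. \<forall>h\<in>X. \<psi> (\<lambda>z. f z + h z) = \<psi> f + \<psi> h) \<and>
     (\<forall>c. \<forall>f\<in>X. \<psi> (\<lambda>z. c * f z) = c * \<psi> f) \<and>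
     (\<exists>C. \<forall>f\<in>X. cmod (\<psi> f) \<le> C * p f)}"

definition weak_topology ::
  "(complex \<Rightarrow> complex) set \<Rightarrow> ((complex \<Rightarrow> complex) \<Rightarrow> real) \<Rightarrow> (complex \<Rightarrow> complex) topology" where
  "weak_topology X p =
     topology_generated_by {{f \<in> X. \<psi> f \<in> U} | \<psi> U. \<psi> \<in> dual_space X p \<and> open U}"

definition relatively_compactin :: "'a topology \<Rightarrow> 'a set \<Rightarrow> bool" where
  "relatively_compactin T S \<longleftrightarrow> S \<subseteq> topspace T \<and> compactin T (T closure_of S)"

definition bounded_operator ::
  "(complex \<Rightarrow> complex) set \<Rightarrow> ((complex \<Rightarrow> complex) \<Rightarrow> real) \<Rightarrow>
   (complex \<Rightarrow> complex) set \<Rightarrow> ((complex \<Rightarrow> complex) \<Rightarrow> real) \<Rightarrow>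
   ((complex \<Rightarrow> complex) \<Rightarrow> complex \<Rightarrow> complex) \<Rightarrow> bool" where
  "bounded_operator X p Y q T \<longleftrightarrow>
     (\<forall>f\<in>X. T f \<in> Y) \<and>
     (\<forall>f\<in>X. \<forall>h\<in>X. T (\<lambda>z. f z + h z) = (\<lambda>z. T f z + T h z)) \<and>
     (\<forall>c. \<forall>f\<in>X. T (\<lambda>z. c * f z) = (\<lambda>z. c * T f z)) \<and>
     (\<exists>C. \<forall>f\<in>X. q (T f) \<le> C * p f)"

definition compact_operator ::
  "(complex \<Rightarrow> complex) set \<Rightarrow> ((complex \<Rightarrow> complex) \<Rightarrow> real) \<Rightarrow>
   (complex \<Rightarrow> complex) set \<Rightarrow> ((complex \<Rightarrow> complex) \<Rightarrow> real) \<Rightarrow>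
   ((complex \<Rightarrow> complex) \<Rightarrow> complex \<Rightarrow> complex) \<Rightarrow> bool" where
  "compact_operator X p Y q T \<longleftrightarrow>
     bounded_operator X p Y q T \<and>
     relatively_compactin (norm_topology Y q) (T ` {f \<in> X. p f \<le> 1})"

definition weakly_compact_operator ::
  "(complex \<Rightarrow> complex) set \<Rightarrow> ((complex \<Rightarrow> complex) \<Rightarrow> real) \<Rightarrow>
   (complex \<Rightarrow> complex) set \<Rightarrow> ((complex \<Rightarrow> complex) \<Rightarrow> real) \<Rightarrow>
   ((complex \<Rightarrow> complex) \<Rightarrow> complex \<Rightarrow> complex) \<Rightarrow> bool" where
  "weakly_compact_operator X p Y q T \<longleftrightarrow>
     bounded_operator X p Y q T \<and>
     relatively_compactin (weak_topology Y q) (T ` {f \<in> X. p f \<le> 1})"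


section \<open>The topologies are the intended ones\<close>

lemma Metric_space_norm_dist:
  assumes pos: "\<And>z. u z > 0" and sub: "X \<subseteq> Hinf u"
  shows "Metric_space X (norm_dist X (wnorm u))"
proof -
  have bdd: "bdd_above (range (\<lambda>z. u z * cmod (f z - h z)))" if "f \<in> X" "h \<in> X" for f h
  proof -
    have "bdd_above (range (\<lambda>z. u z * cmod (f z)))" "bdd_above (range (\<lambda>z. u z * cmod (h z)))"
      using that sub by (auto simp: Hinf_def)
    then obtain A B where AB: "\<And>z. u z * cmod (f z) \<le> A" "\<And>z. u z * cmod (h z) \<le> B"
      unfolding bdd_above_def by blast
    have "u z * cmod (f z - h z) \<le> A + B" for z
    proof -
      have "u z * cmod (f z - h z) \<le> u z * (cmod (f z) + cmod (h z))"
        using pos[of z] by (intro mult_left_mono norm_triangle_ineq4) auto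
      also have "\<dots> \<le> A + B" using AB[of z] by (simp add: distrib_left)
      finally show ?thesis .
    qed
    then show ?thesis by (intro bdd_aboveI2)
  qed
  have up: "u z * cmod (f z - h z) \<le> wnorm u (\<lambda>z. f z - h z)" if "f \<in> X" "h \<in> X" for f h z
    unfolding wnorm_def by (intro cSUP_upper bdd that) auto
  have nn: "0 \<le> wnorm u (\<lambda>z. f z - h z)" if "f \<in> X" "h \<in> X" for f h
    using up[OF that, of 0] pos[of 0]
    by (meson norm_ge_zero order.strict_implies_order order_trans mult_nonneg_nonneg)
  show ?thesis
  proof
    fix f h show "0 \<le> norm_dist X (wnorm u) f h" using nn by (auto simp: norm_dist_def)
    show "norm_dist X (wnorm u) f h = norm_dist X (wnorm u) h f"
      by (auto simp: norm_dist_def wnorm_def norm_minus_commute)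
  next
    fix f h assume fh: "f \<in> X" "h \<in> X"
    show "norm_dist X (wnorm u) f h = 0 \<longleftrightarrow> f = h"
    proof
      assume "norm_dist X (wnorm u) f h = 0"
      then have "u z * cmod (f z - h z) \<le> 0" for z using up[OF fh, of z] fh by (simp add: norm_dist_def)
      then have "f z = h z" for z
        using pos[of z] by (smt (verit) mult_pos_pos zero_less_norm_iff right_minus_eq)
      then show "f = h" by auto
    qed (use fh in \<open>simp add: norm_dist_def wnorm_def\<close>)
  next
    fix f h k assume X: "f \<in> X" "h \<in> X" "k \<in> X"
    have "wnorm u (\<lambda>z. f z - k z) \<le> wnorm u (\<lambda>z. f z - h z) + wnorm u (\<lambda>z. h z - k z)"
      unfolding wnorm_def[of u "\<lambda>z. f z - k z"]
    proof (rule cSUP_least)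
      fix z
      have "cmod (f z - k z) \<le> cmod (f z - h z) + cmod (h z - k z)"
        using norm_triangle_ineq[of "f z - h z" "h z - k z"] by simp
      then have "u z * cmod (f z - k z) \<le> u z * cmod (f z - h z) + u z * cmod (h z - k z)"
        using pos[of z] by (metis distrib_left mult_left_mono order.strict_implies_order)
      then show "u z * cmod (f z - k z) \<le> wnorm u (\<lambda>z. f z - h z) + wnorm u (\<lambda>z. h z - k z)"
        using up[of f h z] up[of h k z] X by linarith
    qed auto
    then show "norm_dist X (wnorm u) f k \<le> norm_dist X (wnorm u) f h + norm_dist X (wnorm u) h k"
      using X by (simp add: norm_dist_def)
  qed
qed

lemma topspace_weak_topology: "topspace (weak_topology X p) = X"
proof -
  have "(\<lambda>_. 0) \<in> dual_space X p"
    by (auto simp: dual_space_def intro: exI[of _ 0])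
  then have "X \<in> {{f \<in> X. \<psi> f \<in> U} | \<psi> U. \<psi> \<in> dual_space X p \<and> open U}"
    by (intro CollectI exI[of _ "\<lambda>_. 0"] exI[of _ UNIV]) auto
  then show ?thesis unfolding weak_topology_def topology_generated_by_topspace by blast
qed

end

theory Submission
  imports Defs
begin

text \<open>Call \<open>Hinf u\<close> the big-O space and \<open>H0 u\<close> the little-o space of the weight \<open>u\<close>.

  Since \<open>volterra g f\<close> is the primitive of \<open>f * g'\<close> vanishing at \<open>0\<close>, everything is decided by comparing
  derivatives in the target space with \<open>\<phi>'\<close>.  The growth condition on \<open>\<phi>\<close> makes this comparison
  exact (\<open>Cauchy_estimate\<close>, \<open>deriv_small_if_H0\<close>, \<open>volterra_bound\<close>): if \<open>F = O(\<phi>)\<close> then \<open>F' = O(\<phi>')\<close>, with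
  a corresponding norm bound, and \<open>F = o(\<phi>)\<close> if and only if \<open>F' = o(\<phi>')\<close>.  Pointwise, the supremum
  of \<open>|f * g'| / \<phi>'\<close> over the unit ball of the source is the quotient in \<open>C3\<close>.

  If that quotient tends to \<open>0\<close>, the images of the unit ball are \<open>o(\<phi>)\<close> uniformly, and Montel's
  theorem gives compactness (\<open>compact_operator_if_symbol_small\<close>), whichever of the two pairs of
  spaces is considered.

  The converses test the operator on dilates \<open>f (r * z)\<close> with \<open>r < 1\<close>.  These are norm limits of
  polynomials, so they lie in the little-o space, with norm at most that of \<open>f\<close>, and a bounded Volterra
  operator maps them into the little-o target space (\<open>volterra_dilation_in_H0\<close>).  For a compact operator
  the set of these images is totally bounded, hence their derivatives are \<open>o(\<phi>')\<close> uniformly, and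
  \<open>r \<rightarrow> 1\<close> yields \<open>C3\<close>.  For a weakly compact operator a weak cluster point as \<open>r \<rightarrow> 1\<close> shows that the image of
  every \<open>f\<close> in the big-O space is in the little-o space (\<open>volterra_Hinf_into_H0_if_weakly_compact\<close>).
  If \<open>C3\<close> failed along some sequence, a function interpolating the extremal values on a subsequence
  would contradict this.\<close>

section \<open>Weighted sup-norms and relative compactness\<close>

lemma Hinf_iff_bounded: "f \<in> Hinf u \<longleftrightarrow> f holomorphic_on UNIV \<and> (\<exists>C. \<forall>z. u z * cmod (f z) \<le> C)"
  unfolding Hinf_def bdd_above_def by auto

lemma le_wnorm: "f \<in> Hinf u \<Longrightarrow> u z * cmod (f z) \<le> wnorm u f"
  unfolding wnorm_def Hinf_def by (intro cSUP_upper) auto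

lemma wnorm_le: "(\<And>z. u z * cmod (f z) \<le> C) \<Longrightarrow> wnorm u f \<le> C"
  unfolding wnorm_def by (intro cSUP_least) auto

lemma wnorm_nonneg:
  assumes "f \<in> Hinf u" "\<And>z. 0 < u z"
  shows "0 \<le> wnorm u f"
proof -
  have "0 \<le> u 0 * cmod (f 0)" using assms(2)[of 0] by simp
  also have "\<dots> \<le> wnorm u f" by (rule le_wnorm[OF assms(1)])
  finally show ?thesis .
qed

lemma Hinf_diff:
  assumes "f \<in> Hinf u" "h \<in> Hinf u" and pos: "\<And>z. 0 < u z"
  shows "(\<lambda>z. f z - h z) \<in> Hinf u"
proof -
  have "u z * cmod (f z - h z) \<le> wnorm u f + wnorm u h" for z
  proof -
    have "u z * cmod (f z - h z) \<le> u z * (cmod (f z) + cmod (h z))"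
      using pos[of z] by (intro mult_left_mono norm_triangle_ineq4) auto
    also have "\<dots> \<le> wnorm u f + wnorm u h"
      using le_wnorm[OF assms(1), of z] le_wnorm[OF assms(2), of z] by (simp add: distrib_left)
    finally show ?thesis .
  qed
  then show ?thesis
    using assms unfolding Hinf_iff_bounded by (auto intro!: holomorphic_intros)
qed

lemma Hinf_scale:
  assumes "f \<in> Hinf u"
  shows "(\<lambda>z. c * f z) \<in> Hinf u"
proof -
  have "u z * cmod (c * f z) \<le> cmod c * wnorm u f" for z
    using mult_left_mono[OF le_wnorm[OF assms, of z], of "cmod c"]
    by (simp add: norm_mult mult_ac)
  then show ?thesis
    using assms unfolding Hinf_iff_bounded by (auto intro!: holomorphic_intros)
qed

lemma wnorm_scale_le:
  assumes "f \<in> Hinf u"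
  shows "wnorm u (\<lambda>z. c * f z) \<le> cmod c * wnorm u f"
proof (rule wnorm_le)
  fix z
  show "u z * cmod (c * f z) \<le> cmod c * wnorm u f"
    using mult_left_mono[OF le_wnorm[OF assms, of z], of "cmod c"]
    by (simp add: norm_mult mult_ac)
qed

lemma tendsto_0_at_infinity_iff:
  fixes q :: "complex \<Rightarrow> real"
  assumes nonneg: "\<forall>z. r \<le> cmod z \<longrightarrow> 0 \<le> q z"
  shows "(q \<longlongrightarrow> 0) at_infinity \<longleftrightarrow> (\<forall>e>0. \<exists>R. \<forall>z. R \<le> cmod z \<longrightarrow> q z \<le> e)"
proof
  assume L: "(q \<longlongrightarrow> 0) at_infinity"
  show "\<forall>e>0. \<exists>R. \<forall>z. R \<le> cmod z \<longrightarrow> q z \<le> e"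
  proof (intro allI impI)
    fix e :: real assume "0 < e"
    then have "\<forall>\<^sub>F z in at_infinity. \<bar>q z\<bar> < e"
      using tendstoD[OF L] by (simp add: dist_real_def)
    then obtain R where "\<And>z. R \<le> cmod z \<Longrightarrow> \<bar>q z\<bar> < e"
      unfolding eventually_at_infinity by blast
    then show "\<exists>R. \<forall>z. R \<le> cmod z \<longrightarrow> q z \<le> e" by (intro exI[of _ R]) (auto simp: abs_less_iff less_imp_le)
  qed
next
  assume R: "\<forall>e>0. \<exists>R. \<forall>z. R \<le> cmod z \<longrightarrow> q z \<le> e"
  show "(q \<longlongrightarrow> 0) at_infinity"
  proof (rule tendstoI)
    fix e :: real assume "0 < e"
    then obtain R where R: "\<And>z. R \<le> cmod z \<Longrightarrow> q z \<le> e / 2" using R by (meson half_gt_zero)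
    have "dist (q z) 0 < e" if "max r R \<le> cmod z" for z
      using nonneg R[of z] that \<open>0 < e\<close> by (simp add: dist_real_def)
    then show "\<forall>\<^sub>F z in at_infinity. dist (q z) 0 < e" unfolding eventually_at_infinity by blast
  qed
qed

lemma H0_iff_small:
  assumes pos: "\<And>z. 0 < u z"
  shows "f \<in> H0 u \<longleftrightarrow> f holomorphic_on UNIV \<and>
    (\<forall>e>0. \<exists>R. \<forall>z. R \<le> cmod z \<longrightarrow> u z * cmod (f z) \<le> e)"
proof -
  have "0 \<le> u z * cmod (f z)" for z using pos[of z] by simp
  then show ?thesis by (simp add: H0_def tendsto_0_at_infinity_iff[where r = 0])
qed

lemma H0_scale:
  assumes "f \<in> H0 u"
  shows "(\<lambda>z. c * f z) \<in> H0 u"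
proof -
  have "((\<lambda>z. cmod c * (u z * cmod (f z))) \<longlongrightarrow> 0) at_infinity"
    using assms by (intro tendsto_mult_right_zero) (simp add: H0_def)
  then show ?thesis
    using assms by (auto simp: H0_def norm_mult mult_ac intro!: holomorphic_intros)
qed

lemma H0_add:
  assumes "f \<in> H0 u" "h \<in> H0 u" and pos: "\<And>z. 0 < u z"
  shows "(\<lambda>z. f z + h z) \<in> H0 u"
proof -
  have "((\<lambda>z. u z * cmod (f z) + u z * cmod (h z)) \<longlongrightarrow> 0) at_infinity"
    using assms unfolding H0_def by (auto intro: tendsto_add_zero)
  then have "((\<lambda>z. u z * cmod (f z + h z)) \<longlongrightarrow> 0) at_infinity"
  proof (rule Lim_null_comparison[rotated])
    show "\<forall>\<^sub>F z in at_infinity. norm (u z * cmod (f z + h z)) \<le> u z * cmod (f z) + u z * cmod (h z)"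
      using pos by (auto simp: abs_mult less_imp_le norm_triangle_ineq simp flip: distrib_left)
  qed
  then show ?thesis using assms by (auto simp: H0_def intro!: holomorphic_intros)
qed

lemma H0_diff:
  assumes "f \<in> H0 u" "h \<in> H0 u" "\<And>z. 0 < u z"
  shows "(\<lambda>z. f z - h z) \<in> H0 u"
  using H0_add[OF assms(1) H0_scale[OF assms(2), of "-1"] assms(3)] by simp

lemma H0_subset_Hinf:
  assumes pos: "\<And>z. 0 < u z" and cont: "continuous_on UNIV u"
  shows "H0 u \<subseteq> Hinf u"
proof
  fix f assume f: "f \<in> H0 u"
  then have hol: "f holomorphic_on UNIV" by (simp add: H0_def)
  obtain R where R: "\<And>z. R \<le> cmod z \<Longrightarrow> u z * cmod (f z) \<le> 1"
    using f unfolding H0_iff_small[OF pos] by (metis zero_less_one)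
  have "compact ((\<lambda>z. u z * cmod (f z)) ` cball 0 R)"
    by (intro compact_continuous_image continuous_intros continuous_on_subset[OF cont]
        holomorphic_on_imp_continuous_on holomorphic_on_subset[OF hol]) auto
  then obtain B where "\<forall>x\<in>(\<lambda>z. u z * cmod (f z)) ` cball 0 R. norm x \<le> B"
    using compact_imp_bounded bounded_iff by metis
  then have B: "u z * cmod (f z) \<le> B" if "cmod z \<le> R" for z
    using that by (force dest!: bspec[where x = "u z * cmod (f z)"])
  have "u z * cmod (f z) \<le> max 1 B" for z
    using R[of z] B[of z] by (cases "R \<le> cmod z") auto
  then show "f \<in> Hinf u" using hol by (auto simp: Hinf_iff_bounded)
qed

text \<open>Montel's theorem gives a subsequence converging uniformly on compact sets, and the uniform
  smallness at infinity upgrades this to convergence in the weighted norm: outside a large disc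
  both the sequence and its limit are small, inside it the weight is bounded.  The target \<open>Y\<close> is
  kept between the little-o and the big-O space so that one statement covers both.\<close>

lemma relatively_compact_if_uniformly_small_at_infinity:
  assumes pos: "\<And>z. 0 < u z" and cont: "continuous_on UNIV u"
    and Y: "H0 u \<subseteq> Y" "Y \<subseteq> Hinf u"
    and S: "S \<subseteq> H0 u"
    and loc: "\<And>R. \<exists>B. \<forall>F\<in>S. \<forall>z. cmod z \<le> R \<longrightarrow> cmod (F z) \<le> B"
    and tail: "\<And>e. 0 < e \<Longrightarrow> \<exists>R. \<forall>F\<in>S. \<forall>z. R \<le> cmod z \<longrightarrow> u z * cmod (F z) \<le> e"
  shows "relatively_compactin (norm_topology Y (wnorm u)) S"
proof -
  interpret Y: Metric_space Y "norm_dist Y (wnorm u)"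
    by (rule Metric_space_norm_dist[OF pos Y(2)])
  have SY: "S \<subseteq> Y" using S Y by blast
  have holS: "F holomorphic_on UNIV" if "F \<in> S" for F using that S by (auto simp: H0_def)
  have "\<exists>l r. l \<in> Y \<and> strict_mono r \<and> limitin Y.mtopology (\<sigma> \<circ> r) l sequentially"
    if \<sigma>: "range \<sigma> \<subseteq> S" for \<sigma> :: "nat \<Rightarrow> complex \<Rightarrow> complex"
  proof -
    have \<sigma>S: "\<sigma> n \<in> S" for n using \<sigma> by auto
    have bdK: "\<exists>B. \<forall>h\<in>S. \<forall>z\<in>K. cmod (h z) \<le> B" if K: "compact K" for K
    proof -
      obtain R where "\<forall>z\<in>K. cmod z \<le> R"
        using compact_imp_bounded[OF K] unfolding bounded_iff by blast
      then show ?thesis using loc[of R] by metis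
    qed
    obtain l r where l: "l holomorphic_on UNIV" and r: "strict_mono (r :: nat \<Rightarrow> nat)"
      and ptw: "\<And>z. (\<lambda>n. \<sigma> (r n) z) \<longlonglongrightarrow> l z"
      and unif: "\<And>K. compact K \<Longrightarrow> uniform_limit K (\<sigma> \<circ> r) l sequentially"
    proof (rule Montel[of UNIV S \<sigma>])
      show "\<exists>B. \<forall>h\<in>S. \<forall>z\<in>K. cmod (h z) \<le> B" if "compact K" for K
        by (rule bdK[OF that])
    qed (use holS \<sigma> in auto)
    have ltail: "\<exists>R. \<forall>z. R \<le> cmod z \<longrightarrow> u z * cmod (l z) \<le> e \<and> (\<forall>n. u z * cmod (\<sigma> n z) \<le> e)"
      if e: "0 < e" for e
    proof -
      obtain R where R: "\<And>F z. F \<in> S \<Longrightarrow> R \<le> cmod z \<Longrightarrow> u z * cmod (F z) \<le> e"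
        using tail[OF e] by blast
      have "u z * cmod (l z) \<le> e" if "R \<le> cmod z" for z
        by (rule LIMSEQ_le_const2[where X = "\<lambda>n. u z * cmod (\<sigma> (r n) z)"])
          (use R[OF \<sigma>S that] in \<open>auto intro!: tendsto_intros ptw\<close>)
      then show ?thesis using R[OF \<sigma>S] by blast
    qed
    have lH0: "l \<in> H0 u" unfolding H0_iff_small[OF pos] using l ltail by blast
    then have lY: "l \<in> Y" using Y by blast
    have "limitin Y.mtopology (\<sigma> \<circ> r) l sequentially"
      unfolding Y.limitin_metric
    proof (intro conjI lY allI impI)
      fix e :: real assume e: "0 < e"
      obtain R where R: "\<And>z. R \<le> cmod z \<Longrightarrow> u z * cmod (l z) \<le> e / 4"
          "\<And>z n. R \<le> cmod z \<Longrightarrow> u z * cmod (\<sigma> n z) \<le> e / 4"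
        using ltail[of "e / 4"] e by auto
      have "compact (u ` cball 0 R)"
        by (intro compact_continuous_image continuous_on_subset[OF cont]) auto
      then obtain B where "\<forall>x\<in>u ` cball 0 R. norm x \<le> B"
        using compact_imp_bounded bounded_iff by metis
      then have B: "u z \<le> B" if "cmod z \<le> R" for z
        using that by (force dest!: bspec[where x = "u z"])
      define B' where "B' = max B 1"
      have B': "B' > 0" "\<And>z. cmod z \<le> R \<Longrightarrow> u z \<le> B'" using B by (fastforce simp: B'_def)+
      have "\<forall>\<^sub>F n in sequentially. \<forall>z\<in>cball 0 R. dist ((\<sigma> \<circ> r) n z) (l z) < e / (2 * B')"
        using unif[of "cball 0 R"] e B' unfolding uniform_limit_iff by auto
      then show "\<forall>\<^sub>F n in sequentially. (\<sigma> \<circ> r) n \<in> Y \<and> norm_dist Y (wnorm u) ((\<sigma> \<circ> r) n) l < e"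
      proof eventually_elim
        case (elim n)
        have \<sigma>Y: "(\<sigma> \<circ> r) n \<in> Y" using \<sigma>S SY by auto
        have "u z * cmod ((\<sigma> \<circ> r) n z - l z) \<le> e / 2" for z
        proof (cases "R \<le> cmod z")
          case True
          have "u z * cmod ((\<sigma> \<circ> r) n z - l z) \<le> u z * (cmod (\<sigma> (r n) z) + cmod (l z))"
            using pos[of z] by (intro mult_left_mono) (auto intro: norm_triangle_ineq4)
          also have "\<dots> \<le> e / 2" using R(2)[OF True, of "r n"] R(1)[OF True] by (simp add: distrib_left)
          finally show ?thesis .
        next
          case False
          then have "dist ((\<sigma> \<circ> r) n z) (l z) < e / (2 * B')" using elim by auto
          then have "u z * cmod ((\<sigma> \<circ> r) n z - l z) \<le> B' * (e / (2 * B'))"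
            using B'(2)[of z] False pos[of z] B'(1) by (intro mult_mono) (auto simp: dist_norm)
          also have "\<dots> = e / 2" using B' by simp
          finally show ?thesis .
        qed
        then have "wnorm u (\<lambda>z. (\<sigma> \<circ> r) n z - l z) \<le> e / 2" by (rule wnorm_le)
        then show ?case using e \<sigma>Y lY by (simp add: norm_dist_def)
      qed
    qed
    then show ?thesis using lY r by blast
  qed
  then have "\<forall>T. T \<subseteq> S \<and> infinite T \<longrightarrow> Y \<inter> Y.mtopology derived_set_of T \<noteq> {}"
    using Y.Bolzano_Weierstrass_property[of S Y] SY by blast
  then have "compactin Y.mtopology (Y.mtopology closure_of S)"
    unfolding Y.compact_closure_of_eq_Bolzano_Weierstrass by blast
  then show ?thesis
    unfolding relatively_compactin_def norm_topology_def using SY by simp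
qed

section \<open>Weak topologies and limits at infinity\<close>

lemma evaluation_in_dual_space:
  assumes "Y \<subseteq> Hinf u" "\<And>z. 0 < u z"
  shows "(\<lambda>F. F z) \<in> dual_space Y (wnorm u)"
proof -
  have "cmod (F z) \<le> 1 / u z * wnorm u F" if "F \<in> Y" for F
    using le_wnorm[of F u z] that assms(1) assms(2)[of z] by (auto simp: field_simps)
  then show ?thesis by (auto simp: dual_space_def simp del: times_divide_eq_left)
qed

lemma dual_space_antimono:
  assumes "Y \<subseteq> Z"
  shows "dual_space Z p \<subseteq> dual_space Y p"
proof
  fix \<psi> assume \<psi>: "\<psi> \<in> dual_space Z p"
  then obtain C where "\<forall>f\<in>Z. cmod (\<psi> f) \<le> C * p f" by (auto simp: dual_space_def)
  then have "\<forall>f\<in>Y. cmod (\<psi> f) \<le> C * p f" using assms by blast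
  then show "\<psi> \<in> dual_space Y p"
    using \<psi> subsetD[OF assms] unfolding dual_space_def mem_Collect_eq by meson
qed

lemma openin_weak_topology:
  "\<psi> \<in> dual_space Y p \<Longrightarrow> open U \<Longrightarrow> openin (weak_topology Y p) {F \<in> Y. \<psi> F \<in> U}"
  unfolding weak_topology_def by (rule topology_generated_by_Basis) blast

text \<open>Points of the space are entire functions, and point evaluations are bounded functionals that
  tell them apart.\<close>

lemma Hausdorff_weak_topology:
  assumes "Y \<subseteq> Hinf u" "\<And>z. 0 < u z"
  shows "Hausdorff_space (weak_topology Y (wnorm u))"
  unfolding Hausdorff_space_def topspace_weak_topology
proof (intro allI impI)
  fix F G assume FG: "F \<in> Y \<and> G \<in> Y \<and> F \<noteq> G"
  then obtain z where "F z \<noteq> G z" by auto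
  then obtain U V where "open U" "open V" "F z \<in> U" "G z \<in> V" "U \<inter> V = {}"
    by (metis separation_t2)
  moreover have "openin (weak_topology Y (wnorm u)) {F \<in> Y. F z \<in> W}" if "open W" for W
    by (rule openin_weak_topology[OF evaluation_in_dual_space[OF assms] that])
  ultimately show "\<exists>U V. openin (weak_topology Y (wnorm u)) U \<and> openin (weak_topology Y (wnorm u)) V \<and>
      F \<in> U \<and> G \<in> V \<and> disjnt U V"
    using FG
    by (intro exI[of _ "{F \<in> Y. F z \<in> U}"] exI[of _ "{F \<in> Y. F z \<in> V}"]) (auto simp: disjnt_def)
qed

lemma openin_norm_topology_if_openin_weak_topology:
  assumes Y: "Y \<subseteq> Hinf u" and pos: "\<And>z. 0 < u z"
    and diff: "\<And>F G. F \<in> Y \<Longrightarrow> G \<in> Y \<Longrightarrow> (\<lambda>z. F z - G z) \<in> Y"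
    and W: "openin (weak_topology Y (wnorm u)) W"
  shows "openin (norm_topology Y (wnorm u)) W"
proof -
  interpret Y: Metric_space Y "norm_dist Y (wnorm u)"
    by (rule Metric_space_norm_dist[OF pos Y])
  have basic: "openin Y.mtopology {F \<in> Y. \<psi> F \<in> U}"
    if \<psi>: "\<psi> \<in> dual_space Y (wnorm u)" and U: "open U" for \<psi> U
    unfolding Y.openin_mtopology
  proof (intro conjI allI impI)
    fix F assume F: "F \<in> {F \<in> Y. \<psi> F \<in> U}"
    obtain e where e: "e > 0" "ball (\<psi> F) e \<subseteq> U" using F U open_contains_ball_eq by blast
    obtain C where "\<And>f. f \<in> Y \<Longrightarrow> cmod (\<psi> f) \<le> C * wnorm u f"
      using \<psi> unfolding dual_space_def by blast
    then have C: "cmod (\<psi> f) \<le> max C 1 * wnorm u f" if "f \<in> Y" for f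
      using mult_right_mono[OF max.cobounded1[of C 1] wnorm_nonneg[of f u, OF subsetD[OF Y that] pos]]
        that by (meson order_trans)
    have "Y.mball F (e / max C 1) \<subseteq> {F \<in> Y. \<psi> F \<in> U}"
    proof
      fix G assume G: "G \<in> Y.mball F (e / max C 1)"
      then have GY: "G \<in> Y" "F \<in> Y" and "wnorm u (\<lambda>z. F z - G z) < e / max C 1"
        by (auto simp: Y.in_mball norm_dist_def)
      then have "max C 1 * wnorm u (\<lambda>z. F z - G z) < e" by (simp add: field_simps)
      then have "cmod (\<psi> (\<lambda>z. F z - G z)) < e" using C[OF diff[OF GY(2,1)]] by linarith
      moreover have "\<psi> (\<lambda>z. F z - G z) = \<psi> F - \<psi> G"
      proof -
        have "\<psi> (\<lambda>z. (F z - G z) + G z) = \<psi> (\<lambda>z. F z - G z) + \<psi> G"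
          using \<psi> GY(1) diff[OF GY(2,1)] unfolding dual_space_def mem_Collect_eq by metis
        then show ?thesis by simp
      qed
      ultimately have "\<psi> G \<in> ball (\<psi> F) e" by (simp add: dist_norm)
      then show "G \<in> {F \<in> Y. \<psi> F \<in> U}" using e GY by auto
    qed
    then show "\<exists>r>0. Y.mball F r \<subseteq> {F \<in> Y. \<psi> F \<in> U}"
      using e(1) by (intro exI[of _ "e / max C 1"]) auto
  qed auto
  have "generate_topology_on {{f \<in> Y. \<psi> f \<in> U} | \<psi> U. \<psi> \<in> dual_space Y (wnorm u) \<and> open U} W"
    using W unfolding weak_topology_def by (rule openin_topology_generated_by)
  then show ?thesis
    unfolding norm_topology_def
    by induction (use basic in auto)
qed

text \<open>The norm closure of the image is norm compact, hence compact in the coarser weak topology,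
  hence weakly closed because that topology is Hausdorff; so it contains the weak closure.\<close>

lemma compact_operator_imp_weakly_compact_operator:
  assumes Y: "Y \<subseteq> Hinf u" and pos: "\<And>z. 0 < u z"
    and diff: "\<And>F G. F \<in> Y \<Longrightarrow> G \<in> Y \<Longrightarrow> (\<lambda>z. F z - G z) \<in> Y"
    and T: "compact_operator X p Y (wnorm u) T"
  shows "weakly_compact_operator X p Y (wnorm u) T"
proof -
  interpret Y: Metric_space Y "norm_dist Y (wnorm u)"
    by (rule Metric_space_norm_dist[OF pos Y])
  let ?S = "T ` {f \<in> X. p f \<le> 1}" and ?W = "weak_topology Y (wnorm u)"
  define K where "K = Y.mtopology closure_of ?S"
  have K: "compactin Y.mtopology K" and SY: "?S \<subseteq> Y"
    using T unfolding compact_operator_def relatively_compactin_def norm_topology_def K_def by auto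
  have KY: "K \<subseteq> Y" using compactin_subset_topspace[OF K] by simp
  have SK: "?S \<subseteq> K" unfolding K_def using SY by (simp add: closure_of_subset)
  have open_le: "openin Y.mtopology W" if W: "openin ?W W" for W
    using openin_norm_topology_if_openin_weak_topology[OF Y pos diff, of W] W
    unfolding norm_topology_def by blast
  have "compactin ?W K"
    unfolding compactin_def topspace_weak_topology
  proof (intro conjI KY allI impI)
    fix \<U> assume "Ball \<U> (openin ?W) \<and> K \<subseteq> \<Union>\<U>"
    then have "Ball \<U> (openin Y.mtopology) \<and> K \<subseteq> \<Union>\<U>" using open_le by blast
    then show "\<exists>\<F>. finite \<F> \<and> \<F> \<subseteq> \<U> \<and> K \<subseteq> \<Union>\<F>"
      using K unfolding compactin_def by meson
  qed
  then have "closedin ?W K"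
    by (rule compactin_imp_closedin[OF Hausdorff_weak_topology[OF Y pos]])
  then have "?W closure_of ?S \<subseteq> K" using SK by (simp add: closure_of_minimal)
  then have "compactin ?W (?W closure_of ?S)"
    using closed_compactin[OF \<open>compactin ?W K\<close>] by (simp add: closedin_closure_of)
  then show ?thesis
    using T SY unfolding weakly_compact_operator_def relatively_compactin_def compact_operator_def
    by (simp add: topspace_weak_topology)
qed

text \<open>By the finite intersection property the weak closures of the tails of the sequence have a common
  point \<open>F\<close>.  A functional that converges along the whole sequence must converge to its value at
  \<open>F\<close>, because \<open>F\<close> is in the closure of every tail.\<close>

lemma weak_cluster_point:
  assumes S: "relatively_compactin (weak_topology Y p) S" and x: "\<And>n::nat. x n \<in> S"
  shows "\<exists>F\<in>Y. \<forall>\<psi>\<in>dual_space Y p. \<forall>L. (\<lambda>n. \<psi> (x n)) \<longlonglongrightarrow> L \<longrightarrow> \<psi> F = L"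
proof -
  let ?W = "weak_topology Y p"
  define K where "K = ?W closure_of S"
  have SY: "S \<subseteq> Y" and K: "compactin ?W K"
    using S by (auto simp: relatively_compactin_def K_def topspace_weak_topology)
  define C where "C N = ?W closure_of (x ` {N..})" for N
  have xK: "x n \<in> C N" if "N \<le> n" for n N
    unfolding C_def by (rule subsetD[OF closure_of_subset])
      (use that x SY in \<open>auto simp: topspace_weak_topology\<close>)
  have xinK: "x n \<in> K" for n
    unfolding K_def by (rule subsetD[OF closure_of_subset]) (use x SY in \<open>auto simp: topspace_weak_topology\<close>)
  have "K \<inter> \<Inter>(range C) \<noteq> {}"
  proof -
    have "K \<inter> \<Inter>\<F> \<noteq> {}" if \<F>: "finite \<F>" "\<F> \<subseteq> range C" for \<F>
    proof -
      obtain I where I: "finite I" "\<F> = C ` I" using finite_subset_image[OF \<F>] by blast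
      have "x (Max (insert 0 I)) \<in> K \<inter> \<Inter>\<F>"
        unfolding I using I(1) by (auto intro!: xinK xK Max_ge)
      then show ?thesis by blast
    qed
    then show ?thesis
      using K unfolding compactin_fip by (auto simp: C_def)
  qed
  then obtain F where F: "F \<in> K" "\<And>N. F \<in> C N" by auto
  have FY: "F \<in> Y"
    using F(1) compactin_subset_topspace[OF K] by (auto simp: topspace_weak_topology)
  have "\<psi> F = L" if \<psi>: "\<psi> \<in> dual_space Y p" and L: "(\<lambda>n. \<psi> (x n)) \<longlonglongrightarrow> L" for \<psi> L
  proof (rule ccontr)
    assume "\<psi> F \<noteq> L"
    then obtain U V where UV: "open U" "open V" "\<psi> F \<in> U" "L \<in> V" "U \<inter> V = {}"
      by (metis separation_t2)
    obtain N where N: "\<And>n. n \<ge> N \<Longrightarrow> \<psi> (x n) \<in> V"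
      using topological_tendstoD[OF L UV(2,4)] unfolding eventually_sequentially by blast
    have "openin ?W {G \<in> Y. \<psi> G \<in> U}" by (rule openin_weak_topology[OF \<psi> UV(1)])
    moreover have "F \<in> {G \<in> Y. \<psi> G \<in> U}" using FY UV by auto
    ultimately have "\<exists>y\<in>x ` {N..}. y \<in> {G \<in> Y. \<psi> G \<in> U}"
      using F(2)[of N, unfolded C_def in_closure_of] by meson
    then show False using N UV by auto
  qed
  then show ?thesis using FY by blast
qed

text \<open>The separation theorem needed to see that the little-o space is weakly closed in the big-O space.
  If \<open>u * F\<close> does not vanish at infinity, it stays away from \<open>0\<close> along some \<open>\<zeta> k \<rightarrow> \<infinity>\<close>, and the
  functional sought is a generalised limit of \<open>u (\<zeta> k) * G (\<zeta> k)\<close>.  It is obtained as a cluster point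
  of the evaluation functionals in a product of discs, which is compact by Tychonoff's theorem;
  every closed condition that the evaluations eventually satisfy is inherited by the cluster point.\<close>

lemma generalised_limit_at_infinity:
  assumes pos: "\<And>z. 0 < u z" and F: "F \<in> Hinf u" "F \<notin> H0 u"
  obtains \<psi> where "\<psi> \<in> dual_space (Hinf u) (wnorm u)" "\<And>G. G \<in> H0 u \<Longrightarrow> \<psi> G = 0" "\<psi> F \<noteq> 0"
proof -
  obtain e where e: "0 < e" "\<And>R. \<exists>z. R \<le> cmod z \<and> e < u z * cmod (F z)"
    using F unfolding H0_iff_small[OF pos] Hinf_iff_bounded by (meson linorder_not_le)
  have "\<forall>k::nat. \<exists>z. real k \<le> cmod z \<and> e < u z * cmod (F z)" using e(2) by blast
  then obtain \<zeta> :: "nat \<Rightarrow> complex" where \<zeta>: "\<And>k. real k \<le> cmod (\<zeta> k)" "\<And>k. e < u (\<zeta> k) * cmod (F (\<zeta> k))"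
    by metis
  \<comment> \<open>The value \<open>0\<close> off the big-O space keeps every coordinate in a disc.\<close>
  define \<Psi> where "\<Psi> k G = (if G \<in> Hinf u then of_real (u (\<zeta> k)) * G (\<zeta> k) else 0)"
    for k and G :: "complex \<Rightarrow> complex"
  define D where "D G = (if G \<in> Hinf u then cball 0 (wnorm u G) else {0 :: complex})" for G
  have norm_\<Psi>: "cmod (\<Psi> k G) = u (\<zeta> k) * cmod (G (\<zeta> k))" if "G \<in> Hinf u" for k G
    using that pos[of "\<zeta> k"] by (simp add: \<Psi>_def norm_mult)
  have \<Psi>D: "\<Psi> k \<in> PiE UNIV D" for k
    using le_wnorm norm_\<Psi> by (auto simp: D_def) (simp add: \<Psi>_def)
  have "compactin (product_topology (\<lambda>_. euclidean) UNIV) (PiE UNIV D)"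
    unfolding compactin_PiE by (auto simp: D_def)
  then have "compact (PiE UNIV D)"
    by (simp add: euclidean_product_topology)
  moreover have "filtermap \<Psi> sequentially \<noteq> bot"
    by (simp add: filtermap_bot_iff)
  moreover have "\<forall>\<^sub>F x in filtermap \<Psi> sequentially. x \<in> PiE UNIV D"
    using \<Psi>D by (simp add: eventually_filtermap)
  ultimately obtain \<psi> where \<psi>: "inf (nhds \<psi>) (filtermap \<Psi> sequentially) \<noteq> bot"
    unfolding compact_filter by blast
  have cluster: "P \<psi>" if "closed {x. P x}" "\<forall>\<^sub>F k in sequentially. P (\<Psi> k)" for P
  proof (rule ccontr)
    assume "\<not> P \<psi>"
    then have "\<forall>\<^sub>F x in nhds \<psi>. x \<in> - {x. P x}"
      using that(1) by (intro eventually_nhds_in_open) auto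
    moreover have "\<forall>\<^sub>F x in filtermap \<Psi> sequentially. P x"
      using that(2) by (simp add: eventually_filtermap)
    ultimately have "\<forall>\<^sub>F x in inf (nhds \<psi>) (filtermap \<Psi> sequentially). False"
      unfolding eventually_inf by blast
    then show False using \<psi> by (simp add: trivial_limit_def)
  qed
  note cont = continuous_on_product_coordinates
  have "\<psi> (\<lambda>z. f z + h z) = \<psi> f + \<psi> h" if "f \<in> Hinf u" "h \<in> Hinf u" for f h
  proof (rule cluster)
    have "(\<lambda>z. f z - (- 1) * h z) \<in> Hinf u" by (intro Hinf_diff Hinf_scale that pos)
    then have "(\<lambda>z. f z + h z) \<in> Hinf u" by simp
    then show "\<forall>\<^sub>F k in sequentially. \<Psi> k (\<lambda>z. f z + h z) = \<Psi> k f + \<Psi> k h"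
      using that by (simp add: \<Psi>_def distrib_left)
  qed (intro closed_Collect_eq continuous_intros cont)
  moreover have "\<psi> (\<lambda>z. c * f z) = c * \<psi> f" if "f \<in> Hinf u" for c f
  proof (rule cluster)
    show "\<forall>\<^sub>F k in sequentially. \<Psi> k (\<lambda>z. c * f z) = c * \<Psi> k f"
      using that Hinf_scale[OF that, of c] by (simp add: \<Psi>_def)
  qed (intro closed_Collect_eq continuous_intros cont)
  moreover have "cmod (\<psi> f) \<le> 1 * wnorm u f" if "f \<in> Hinf u" for f
    by (rule cluster)
      (use le_wnorm[OF that] norm_\<Psi>[OF that] in \<open>auto intro!: closed_Collect_le continuous_intros cont\<close>)
  ultimately have "\<psi> \<in> dual_space (Hinf u) (wnorm u)" unfolding dual_space_def by blast
  moreover have "\<psi> G = 0" if G: "G \<in> H0 u" for G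
  proof -
    have "cmod (\<psi> G) \<le> 0 + d" if d: "0 < d" for d
    proof (rule cluster)
      obtain R where R: "\<And>z. R \<le> cmod z \<Longrightarrow> u z * cmod (G z) \<le> d"
        using G d unfolding H0_iff_small[OF pos] by blast
      have "cmod (\<Psi> k G) \<le> 0 + d" if "nat \<lceil>R\<rceil> \<le> k" for k
      proof -
        have "R \<le> cmod (\<zeta> k)" using \<zeta>(1)[of k] that by linarith
        then show ?thesis
          using R norm_\<Psi>[of G k] d by (cases "G \<in> Hinf u") (simp, simp add: \<Psi>_def)
      qed
      then show "\<forall>\<^sub>F k in sequentially. cmod (\<Psi> k G) \<le> 0 + d"
        unfolding eventually_sequentially by blast
    qed (intro closed_Collect_le continuous_intros cont)
    then have "cmod (\<psi> G) \<le> 0" by (rule field_le_epsilon)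
    then show ?thesis by simp
  qed
  moreover have "e \<le> cmod (\<psi> F)"
    by (rule cluster)
      (use \<zeta>(2) norm_\<Psi>[OF F(1)] in \<open>auto intro!: closed_Collect_le continuous_intros cont always_eventually less_imp_le\<close>)
  ultimately show thesis using e(1) that[of \<psi>] by (metis norm_zero not_le)
qed

section \<open>The Volterra operator\<close>

lemma volterra_primitive:
  assumes f: "f holomorphic_on UNIV" and g: "g holomorphic_on UNIV"
  shows "(volterra g f has_field_derivative f z * deriv g z) (at z)" "volterra g f 0 = 0"
proof -
  have "(\<lambda>\<zeta>. f \<zeta> * deriv g \<zeta>) holomorphic_on UNIV"
    using f g by (auto intro!: holomorphic_intros)
  then obtain F where F: "\<And>\<zeta>. (F has_field_derivative f \<zeta> * deriv g \<zeta>) (at \<zeta>)"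
    using holomorphic_convex_primitive'[OF convex_UNIV open_UNIV] by auto
  have V: "volterra g f z = F z - F 0" for z
    unfolding volterra_def
    using contour_integral_unique[OF contour_integral_primitive[of UNIV F _ "linepath 0 z"]] F
    by (simp add: has_field_derivative_at_within)
  show "volterra g f 0 = 0" by (simp add: V)
  have "((\<lambda>z. F z - F 0) has_field_derivative f z * deriv g z) (at z)"
    by (auto intro!: derivative_eq_intros F)
  then show "(volterra g f has_field_derivative f z * deriv g z) (at z)"
    using V by (metis (no_types, lifting) ext)
qed

lemma deriv_volterra:
  "f holomorphic_on UNIV \<Longrightarrow> g holomorphic_on UNIV \<Longrightarrow> deriv (volterra g f) z = f z * deriv g z"
  by (intro DERIV_imp_deriv volterra_primitive)

lemma holomorphic_volterra:
  "f holomorphic_on UNIV \<Longrightarrow> g holomorphic_on UNIV \<Longrightarrow> volterra g f holomorphic_on UNIV"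
  using volterra_primitive(1)[of f g] by (meson holomorphic_onI field_differentiable_def field_differentiable_at_within)

lemma volterra_integrable:
  assumes "f holomorphic_on UNIV" "g holomorphic_on UNIV"
  shows "(\<lambda>\<zeta>. f \<zeta> * deriv g \<zeta>) contour_integrable_on linepath 0 z"
proof -
  have "(\<lambda>\<zeta>. f \<zeta> * deriv g \<zeta>) holomorphic_on UNIV"
    using assms by (auto intro!: holomorphic_intros)
  then show ?thesis
    by (intro contour_integrable_continuous_linepath)
      (meson holomorphic_on_imp_continuous_on continuous_on_subset subset_UNIV)
qed

lemma volterra_add:
  assumes "f holomorphic_on UNIV" "h holomorphic_on UNIV" "g holomorphic_on UNIV"
  shows "volterra g (\<lambda>z. f z + h z) = (\<lambda>z. volterra g f z + volterra g h z)"
  using contour_integral_add[OF volterra_integrable volterra_integrable] assms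
  by (auto simp: volterra_def distrib_right)

lemma volterra_scale:
  assumes "f holomorphic_on UNIV" "g holomorphic_on UNIV"
  shows "volterra g (\<lambda>z. c * f z) = (\<lambda>z. c * volterra g f z)"
  using contour_integral_lmul[OF volterra_integrable] assms
  by (auto simp: volterra_def mult.assoc)

lemma volterra_disc_bound:
  assumes f: "f holomorphic_on UNIV" and g: "g holomorphic_on UNIV"
    and A: "\<And>\<zeta>. cmod \<zeta> \<le> R \<Longrightarrow> cmod (f \<zeta> * deriv g \<zeta>) \<le> A" and z: "cmod z \<le> R"
  shows "cmod (volterra g f z) \<le> A * R"
proof -
  have R: "0 \<le> R" using z norm_ge_zero order_trans by blast
  have "0 \<le> A" using A[of 0] R norm_ge_zero order_trans by (metis norm_zero)
  have "cmod (volterra g f z - volterra g f 0) \<le> A * cmod (z - 0)"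
    by (rule field_differentiable_bound[OF convex_cball[of 0 R]])
      (use volterra_primitive(1)[OF f g] A z R in \<open>auto intro: has_field_derivative_at_within\<close>)
  also have "\<dots> \<le> A * R" using z \<open>0 \<le> A\<close> by (simp add: mult_left_mono)
  finally show ?thesis by (simp add: volterra_primitive(2)[OF f g])
qed

text \<open>On a disc the dilates of \<open>f\<close> converge uniformly to \<open>f\<close>, by uniform continuity, and integration
  preserves this.\<close>

lemma volterra_dilations_converge:
  fixes r :: "nat \<Rightarrow> real"
  assumes f: "f holomorphic_on UNIV" and g: "g holomorphic_on UNIV"
    and r: "\<And>n. 0 < r n" "\<And>n. r n < 1" "r \<longlonglongrightarrow> 1"
  shows "(\<lambda>n. volterra g (\<lambda>\<zeta>. f (of_real (r n) * \<zeta>)) z) \<longlonglongrightarrow> volterra g f z"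
proof -
  define R where "R = cmod z + 1"
  have R: "0 < R" "cmod z \<le> R" by (auto simp: R_def add_nonneg_pos)
  have "compact (deriv g ` cball 0 R)"
    using holomorphic_deriv[OF g open_UNIV]
    by (intro compact_continuous_image holomorphic_on_imp_continuous_on) (auto intro: holomorphic_on_subset)
  then obtain G where G: "0 < G" "\<And>z. cmod z \<le> R \<Longrightarrow> cmod (deriv g z) \<le> G"
    using compact_imp_bounded bounded_pos by (metis (mono_tags, lifting) image_eqI mem_cball_0)
  have "uniformly_continuous_on (cball 0 R) f"
    using f by (intro compact_uniformly_continuous holomorphic_on_imp_continuous_on)
      (auto intro: holomorphic_on_subset)
  show ?thesis
  proof (rule tendstoI)
    fix e :: real assume e: "0 < e"
    have "0 < e / (2 * G * R)" using e G R by simp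
    then obtain d where d: "0 < d"
      "\<And>x y. x \<in> cball 0 R \<Longrightarrow> y \<in> cball 0 R \<Longrightarrow> dist y x < d \<Longrightarrow> dist (f y) (f x) < e / (2 * G * R)"
      using \<open>uniformly_continuous_on (cball 0 R) f\<close> unfolding uniformly_continuous_on_def by metis
    have "\<forall>\<^sub>F n in sequentially. dist (r n) 1 < d / R"
      using d(1) R by (intro tendstoD[OF r(3)]) simp
    then show "\<forall>\<^sub>F n in sequentially.
        dist (volterra g (\<lambda>\<zeta>. f (of_real (r n) * \<zeta>)) z) (volterra g f z) < e"
    proof eventually_elim
      case (elim n)
      let ?f = "\<lambda>\<zeta>. f (of_real (r n) * \<zeta>)" and ?d = "\<lambda>\<zeta>. f (of_real (r n) * \<zeta>) - f \<zeta>"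
      have "(f \<circ> (\<lambda>\<zeta>. of_real (r n) * \<zeta>)) holomorphic_on UNIV"
        by (intro holomorphic_on_compose_gen[OF _ f] holomorphic_intros) auto
      then have hol: "?d holomorphic_on UNIV" using f by (auto simp: o_def intro!: holomorphic_intros)
      have "cmod (volterra g ?d z) \<le> e / (2 * G * R) * G * R"
      proof (rule volterra_disc_bound[OF hol g _ R(2)])
        fix \<zeta> assume \<zeta>: "cmod \<zeta> \<le> R"
        have "cmod (of_real (r n) * \<zeta>) \<le> cmod \<zeta>"
          using r(1,2)[of n] by (simp add: norm_mult mult_left_le_one_le)
        moreover have "dist (of_real (r n) * \<zeta>) \<zeta> < d"
        proof -
          have "of_real (r n) * \<zeta> - \<zeta> = of_real (r n - 1) * \<zeta>" by (simp add: algebra_simps)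
          then have "dist (of_real (r n) * \<zeta>) \<zeta> = \<bar>r n - 1\<bar> * cmod \<zeta>"
            by (simp only: dist_norm norm_mult norm_of_real)
          also have "\<dots> \<le> \<bar>r n - 1\<bar> * R" using \<zeta> by (simp add: mult_left_mono)
          also have "\<dots> < d" using elim R by (simp add: dist_real_def field_simps)
          finally show ?thesis .
        qed
        ultimately have "cmod (?d \<zeta>) \<le> e / (2 * G * R)"
          using d(2)[of \<zeta> "of_real (r n) * \<zeta>"] \<zeta> by (simp add: dist_norm)
        then show "cmod (?d \<zeta> * deriv g \<zeta>) \<le> e / (2 * G * R) * G"
          unfolding norm_mult using G \<zeta> e R by (intro mult_mono) auto
      qed
      also have "\<dots> < e" using e G R by simp
      finally have "cmod (volterra g ?d z) < e" .
      moreover have "volterra g (\<lambda>\<zeta>. ?d \<zeta> + f \<zeta>) = (\<lambda>z. volterra g ?d z + volterra g f z)"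
        by (rule volterra_add[OF hol f g])
      then have "volterra g ?f z - volterra g f z = volterra g ?d z" by (simp add: fun_eq_iff)
      ultimately show ?case by (simp add: dist_norm)
    qed
  qed
qed

section \<open>Target weights of controlled growth\<close>

text \<open>The bound on \<open>\<phi>'' * \<phi> / \<phi>'\<^sup>2\<close> controls the length scale \<open>\<phi> / \<phi>'\<close> on which \<open>\<phi>\<close> changes by a
  constant factor: since \<open>(\<phi> / \<phi>')' = 1 - \<phi>'' * \<phi> / \<phi>'\<^sup>2\<close>, this scale cannot decrease at more than a
  fixed rate.\<close>

locale growth_function =
  fixes \<phi> \<phi>' \<phi>'' :: "real \<Rightarrow> real" and r0 :: real
  assumes cont: "continuous_on {0..} \<phi>"
    and mono: "mono_on {0..} \<phi>"
    and pos: "\<And>r. 0 \<le> r \<Longrightarrow> 0 < \<phi> r"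
    and r0_pos: "0 < r0"
    and deriv_within: "\<And>r. r0 \<le> r \<Longrightarrow> (\<phi> has_real_derivative \<phi>' r) (at r within {r0..})"
    and deriv'_within: "\<And>r. r0 \<le> r \<Longrightarrow> (\<phi>' has_real_derivative \<phi>'' r) (at r within {r0..})"
    and mono': "mono_on {r0..} \<phi>'"
    and pos'_r0: "0 < \<phi>' r0"
    and quotient_bdd: "bdd_above ((\<lambda>r. \<phi>'' r * \<phi> r / (\<phi>' r)\<^sup>2) ` {r0..})"
begin

definition w :: "complex \<Rightarrow> real" where "w z = 1 / \<phi> (cmod z)"

lemma w_pos: "0 < w z"
  by (simp add: w_def pos)

lemma continuous_w: "continuous_on UNIV w"
proof -
  have "continuous_on UNIV (\<lambda>z :: complex. \<phi> (cmod z))"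
    by (rule continuous_on_compose2[OF cont]) (auto intro: continuous_intros)
  moreover have "\<phi> (cmod z) \<noteq> 0" for z :: complex
    using pos[of "cmod z"] by simp
  ultimately show ?thesis
    unfolding w_def by (intro continuous_intros) auto
qed

lemma w_mult_le_iff: "w z * x \<le> c \<longleftrightarrow> x \<le> c * \<phi> (cmod z)"
  using pos[of "cmod z"] by (simp add: w_def field_simps)

lemma pos': "r0 \<le> r \<Longrightarrow> 0 < \<phi>' r"
  using pos'_r0 mono_onD[OF mono', of r0 r] by auto

lemma DERIV: "r0 < r \<Longrightarrow> (\<phi> has_real_derivative \<phi>' r) (at r)"
  using deriv_within[of r] at_within_interior[of r "{r0..}"] by simp

lemma DERIV': "r0 < r \<Longrightarrow> (\<phi>' has_real_derivative \<phi>'' r) (at r)"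
  using deriv'_within[of r] at_within_interior[of r "{r0..}"] by simp

lemma continuous': "continuous_on {r0..} \<phi>'"
  using deriv'_within by (auto simp: continuous_on_eq_continuous_within intro: DERIV_continuous)

lemma continuous_from_r0: "continuous_on {r0..} \<phi>"
  using cont r0_pos by (auto intro: continuous_on_subset)

lemma phi_eventually_ge: "\<exists>R\<ge>r0. \<forall>r\<ge>R. K \<le> \<phi> r"
proof -
  have lin: "\<phi> r - \<phi>' r0 * r \<ge> \<phi> r0 - \<phi>' r0 * r0" if "r0 \<le> r" for r
  proof (rule DERIV_nonneg_imp_increasing_open[OF that, where f = "\<lambda>t. \<phi> t - \<phi>' r0 * t"])
    fix x assume "r0 < x" "x < r"
    then show "\<exists>y. ((\<lambda>t. \<phi> t - \<phi>' r0 * t) has_real_derivative y) (at x) \<and> 0 \<le> y"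
      using mono_onD[OF mono', of r0 x]
      by (intro exI[of _ "\<phi>' x - \<phi>' r0"]) (auto intro!: derivative_eq_intros DERIV)
  qed (auto intro!: continuous_intros continuous_on_subset[OF continuous_from_r0])
  have "K \<le> \<phi> r" if "max r0 (r0 + K / \<phi>' r0) \<le> r" for r
  proof -
    have "K \<le> \<phi>' r0 * (r - r0)" using that pos'_r0 by (simp add: field_simps)
    also have "\<dots> \<le> \<phi> r" using lin[of r] pos[of r0] r0_pos that by (simp add: algebra_simps)
    finally show ?thesis .
  qed
  then show ?thesis by (intro exI[of _ "max r0 (r0 + K / \<phi>' r0)"]) auto
qed

text \<open>With \<open>h = \<phi> / \<phi>'\<close> and \<open>M \<ge> 1\<close> a bound for the quotient, \<open>h t + M * t\<close> is non-decreasing, so \<open>h\<close> stays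
  above \<open>h r / 2\<close> on an interval of length \<open>h r / (2 * M)\<close> to the right of \<open>r\<close>.  There the logarithmic
  derivative \<open>1 / h\<close> of \<open>\<phi>\<close> is at most \<open>2 / h r\<close>, so \<open>ln \<phi>\<close> increases by at most \<open>1 / M \<le> 1\<close>.\<close>

lemma phi_doubling:
  obtains \<delta> where "0 < \<delta>"
    "\<And>r t. r0 \<le> r \<Longrightarrow> r \<le> t \<Longrightarrow> t \<le> r + \<delta> * (\<phi> r / \<phi>' r) \<Longrightarrow> \<phi> t \<le> exp 1 * \<phi> r"
proof -
  obtain M' where "\<And>r. r0 \<le> r \<Longrightarrow> \<phi>'' r * \<phi> r / (\<phi>' r)\<^sup>2 \<le> M'"
    using quotient_bdd unfolding bdd_above_def by auto
  then obtain M where M: "1 \<le> M" "\<And>r. r0 \<le> r \<Longrightarrow> \<phi>'' r * \<phi> r / (\<phi>' r)\<^sup>2 \<le> M"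
    by (metis max.cobounded1 max.coboundedI2)
  define h where "h t = \<phi> t / \<phi>' t" for t
  have h_pos: "0 < h t" if "r0 \<le> t" for t using pos[of t] pos'[of t] that r0_pos by (simp add: h_def)
  have slope: "h r + M * r \<le> h t + M * t" if "r0 \<le> r" "r \<le> t" for r t
  proof (rule DERIV_nonneg_imp_increasing_open[OF that(2), where f = "\<lambda>t. h t + M * t"])
    fix x assume "r < x" "x < t"
    then have x: "r0 < x" using that by simp
    have "((\<lambda>t. h t + M * t) has_real_derivative
        (\<phi>' x * \<phi>' x - \<phi> x * \<phi>'' x) / (\<phi>' x * \<phi>' x) + M) (at x)"
      unfolding h_def using pos'[of x] x by (auto intro!: derivative_eq_intros DERIV DERIV')
    moreover have "(\<phi>' x * \<phi>' x - \<phi> x * \<phi>'' x) / (\<phi>' x * \<phi>' x) + M =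
        1 - \<phi>'' x * \<phi> x / (\<phi>' x)\<^sup>2 + M"
      using pos'[of x] x by (simp add: field_simps power2_eq_square)
    ultimately show "\<exists>y. ((\<lambda>t. h t + M * t) has_real_derivative y) (at x) \<and> 0 \<le> y"
      using M(2)[of x] x by force
  next
    show "continuous_on {r..t} (\<lambda>t. h t + M * t)"
      unfolding h_def using pos' that
      by (intro continuous_intros continuous_on_subset[OF continuous_from_r0]
          continuous_on_subset[OF continuous']) (auto simp: less_imp_neq[symmetric])
  qed
  show thesis
  proof (rule that)
    show "0 < 1 / (2 * M)" using M by simp
    fix r t assume rt: "r0 \<le> r" "r \<le> t" "t \<le> r + 1 / (2 * M) * (\<phi> r / \<phi>' r)"
    have hr: "0 < h r" by (rule h_pos[OF rt(1)])
    have half: "h r / 2 \<le> h x" if "r \<le> x" "x \<le> t" for x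
    proof -
      have "M * (x - r) \<le> M * (1 / (2 * M) * h r)"
        using that rt M by (intro mult_left_mono) (auto simp: h_def)
      also have "\<dots> = h r / 2" using M by simp
      finally show ?thesis using slope[OF rt(1) that(1)] by (simp add: algebra_simps)
    qed
    have "ln (\<phi> t) - 2 / h r * t \<le> ln (\<phi> r) - 2 / h r * r"
    proof (rule DERIV_nonpos_imp_decreasing_open[OF rt(2), where f = "\<lambda>t. ln (\<phi> t) - 2 / h r * t"])
      fix x assume x: "r < x" "x < t"
      have px: "0 < \<phi> x" "0 < h x" "0 < \<phi>' x" using x rt r0_pos pos h_pos pos' by auto
      have "((\<lambda>t. ln (\<phi> t) - 2 / h r * t) has_real_derivative \<phi>' x / \<phi> x - 2 / h r) (at x)"
        using px x rt hr by (auto intro!: derivative_eq_intros DERIV)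
      moreover have "\<phi>' x / \<phi> x \<le> 2 / h r"
      proof -
        have "\<phi>' x / \<phi> x = 1 / h x" by (simp add: h_def)
        also have "\<dots> \<le> 1 / (h r / 2)" using half[of x] x hr by (intro divide_left_mono) auto
        finally show ?thesis by simp
      qed
      ultimately show "\<exists>y. ((\<lambda>t. ln (\<phi> t) - 2 / h r * t) has_real_derivative y) (at x) \<and> y \<le> 0"
        by force
    next
      have "\<phi> x \<noteq> 0" if "x \<in> {r..t}" for x using pos[of x] that rt r0_pos by auto
      then show "continuous_on {r..t} (\<lambda>t. ln (\<phi> t) - 2 / h r * t)"
        using rt by (intro continuous_intros continuous_on_subset[OF continuous_from_r0]) auto
    qed
    moreover have "2 / h r * (t - r) \<le> 1"
    proof -
      have "t - r \<le> 1 / (2 * M) * h r" using rt by (simp add: h_def)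
      moreover have "0 \<le> 2 / h r" using hr by simp
      ultimately have "2 / h r * (t - r) \<le> 2 / h r * (1 / (2 * M) * h r)" by (rule mult_left_mono)
      also have "\<dots> = 1 / M" using hr M by (simp add: field_simps)
      also have "\<dots> \<le> 1" using M by simp
      finally show ?thesis .
    qed
    ultimately have "ln (\<phi> t) \<le> 1 + ln (\<phi> r)" unfolding right_diff_distrib by linarith
    then have "exp (ln (\<phi> t)) \<le> exp (1 + ln (\<phi> r))" by simp
    then show "\<phi> t \<le> exp 1 * \<phi> r"
      using pos[of t] pos[of r] rt r0_pos by (simp add: exp_add)
  qed
qed

text \<open>Cauchy's inequality on the circle of radius \<open>\<delta> * \<phi> / \<phi>'\<close>, where \<open>\<phi>\<close> grows at most by the factor
  \<open>exp 1\<close>: division by the radius turns \<open>\<phi>\<close> into \<open>\<phi>'\<close>.  The additive constant \<open>A\<close> allows the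
  estimate to be used for functions that are \<open>o(\<phi>)\<close> as well as for those that are \<open>O(\<phi>)\<close>.\<close>

lemma Cauchy_estimate:
  obtains C where "0 < C"
    "\<And>F A B z. F holomorphic_on UNIV \<Longrightarrow> 0 \<le> A \<Longrightarrow> 0 \<le> B \<Longrightarrow>
       (\<And>\<zeta>. cmod (F \<zeta>) \<le> A + B * \<phi> (cmod \<zeta>)) \<Longrightarrow> r0 \<le> cmod z \<Longrightarrow>
       cmod (deriv F z) \<le> C * \<phi>' (cmod z) * (A / \<phi> (cmod z) + B)"
proof -
  obtain \<delta> where \<delta>: "0 < \<delta>"
    "\<And>r t. r0 \<le> r \<Longrightarrow> r \<le> t \<Longrightarrow> t \<le> r + \<delta> * (\<phi> r / \<phi>' r) \<Longrightarrow> \<phi> t \<le> exp 1 * \<phi> r"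
    using phi_doubling by blast
  show thesis
  proof (rule that)
    show "0 < exp 1 / \<delta>" using \<delta> by simp
    fix F A B z
    assume F: "F holomorphic_on UNIV" and AB: "0 \<le> (A::real)" "0 \<le> (B::real)"
      and bd: "\<And>\<zeta>. cmod (F \<zeta>) \<le> A + B * \<phi> (cmod \<zeta>)" and z: "r0 \<le> cmod z"
    let ?r = "cmod z"
    have p: "0 < \<phi> ?r" "0 < \<phi>' ?r" using pos pos' z by auto
    define \<rho> where "\<rho> = \<delta> * (\<phi> ?r / \<phi>' ?r)"
    have \<rho>: "0 < \<rho>" using p \<delta> by (simp add: \<rho>_def)
    have e1: "1 \<le> exp (1::real)" by simp
    have "cmod ((deriv ^^ 1) F z) \<le> fact 1 * (exp 1 * (A + B * \<phi> ?r)) / \<rho> ^ 1"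
    proof (rule Cauchy_inequality[OF _ _ \<rho>])
      fix \<zeta> assume \<zeta>: "cmod (z - \<zeta>) = \<rho>"
      have "\<phi> (cmod \<zeta>) \<le> exp 1 * \<phi> ?r"
      proof (cases "cmod \<zeta> \<le> ?r")
        case True
        then have "\<phi> (cmod \<zeta>) \<le> 1 * \<phi> ?r" using mono_onD[OF mono, of "cmod \<zeta>" ?r] by simp
        also have "\<dots> \<le> exp 1 * \<phi> ?r" using p by (intro mult_right_mono) auto
        finally show ?thesis .
      next
        case False
        have "cmod \<zeta> \<le> ?r + \<rho>"
          using norm_triangle_ineq2[of \<zeta> z] \<zeta> by (simp add: norm_minus_commute)
        then show ?thesis using \<delta>(2)[OF z] False by (simp add: \<rho>_def)
      qed
      then have "A + B * \<phi> (cmod \<zeta>) \<le> 1 * A + B * (exp 1 * \<phi> ?r)"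
        using AB by (simp add: mult_left_mono)
      also have "\<dots> \<le> exp 1 * A + B * (exp 1 * \<phi> ?r)"
        by (intro add_right_mono mult_right_mono e1 AB)
      finally show "cmod (F \<zeta>) \<le> exp 1 * (A + B * \<phi> ?r)"
        using bd[of \<zeta>] by (simp add: algebra_simps)
    qed (use F in \<open>auto intro: holomorphic_on_subset holomorphic_on_imp_continuous_on\<close>)
    also have "fact 1 * (exp 1 * (A + B * \<phi> ?r)) / \<rho> ^ 1 = exp 1 / \<delta> * \<phi>' ?r * (A / \<phi> ?r + B)"
      using p \<delta> by (simp add: \<rho>_def field_simps)
    finally show "cmod (deriv F z) \<le> exp 1 / \<delta> * \<phi>' ?r * (A / \<phi> ?r + B)" by simp
  qed
qed

lemma deriv_bound_Hinf:
  obtains C where "0 < C"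
    "\<And>F z. F \<in> Hinf w \<Longrightarrow> r0 \<le> cmod z \<Longrightarrow> cmod (deriv F z) \<le> C * \<phi>' (cmod z) * wnorm w F"
proof -
  obtain C where C: "0 < C"
    "\<And>F A B z. F holomorphic_on UNIV \<Longrightarrow> 0 \<le> A \<Longrightarrow> 0 \<le> B \<Longrightarrow>
       (\<And>\<zeta>. cmod (F \<zeta>) \<le> A + B * \<phi> (cmod \<zeta>)) \<Longrightarrow> r0 \<le> cmod z \<Longrightarrow>
       cmod (deriv F z) \<le> C * \<phi>' (cmod z) * (A / \<phi> (cmod z) + B)"
    using Cauchy_estimate by blast
  show thesis
  proof (rule that[OF C(1)])
    fix F z assume F: "F \<in> Hinf w" and z: "r0 \<le> cmod z"
    have "cmod (F \<zeta>) \<le> 0 + wnorm w F * \<phi> (cmod \<zeta>)" for \<zeta>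
      using le_wnorm[OF F, of \<zeta>] by (simp add: w_mult_le_iff)
    then show "cmod (deriv F z) \<le> C * \<phi>' (cmod z) * wnorm w F"
      using C(2)[of F 0 "wnorm w F", OF _ _ _ _ z] F wnorm_nonneg[OF F w_pos]
      by (simp add: Hinf_iff_bounded)
  qed
qed

text \<open>Together with \<open>bounds_if_H0_w\<close> this says that \<open>F = o(\<phi>)\<close> means a bound \<open>A + e * \<phi>\<close> on the
  whole plane for every \<open>e > 0\<close>; constants are absorbed because \<open>\<phi>\<close> tends to infinity.\<close>

lemma H0_w_if_bounds:
  assumes F: "F holomorphic_on UNIV"
    and bd: "\<And>e. 0 < e \<Longrightarrow> \<exists>A. \<forall>z. cmod (F z) \<le> A + e * \<phi> (cmod z)"
  shows "F \<in> H0 w"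
  unfolding H0_iff_small[OF w_pos]
proof (intro conjI F allI impI)
  fix e :: real assume e: "0 < e"
  obtain A where A: "\<And>z. cmod (F z) \<le> A + e / 2 * \<phi> (cmod z)" using bd[of "e / 2"] e by auto
  obtain R where R: "\<And>r. R \<le> r \<Longrightarrow> A / (e / 2) \<le> \<phi> r" using phi_eventually_ge by blast
  have "w z * cmod (F z) \<le> e" if "R \<le> cmod z" for z
    using A[of z] R[OF that] e unfolding w_mult_le_iff by (simp add: field_simps)
  then show "\<exists>R. \<forall>z. R \<le> cmod z \<longrightarrow> w z * cmod (F z) \<le> e" by blast
qed

lemma bounds_if_H0_w:
  assumes F: "F \<in> H0 w" and e: "0 < e"
  obtains A where "0 \<le> A" "\<And>z. cmod (F z) \<le> A + e * \<phi> (cmod z)"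
proof -
  have hol: "F holomorphic_on UNIV" using F by (simp add: H0_def)
  obtain R where R: "\<And>z. R \<le> cmod z \<Longrightarrow> w z * cmod (F z) \<le> e"
    using F e unfolding H0_iff_small[OF w_pos] by blast
  have "compact (F ` cball 0 R)"
    by (intro compact_continuous_image holomorphic_on_imp_continuous_on holomorphic_on_subset[OF hol]) auto
  then obtain A where A: "0 < A" "\<And>z. cmod z \<le> R \<Longrightarrow> cmod (F z) \<le> A"
    using compact_imp_bounded bounded_pos by (metis (mono_tags) image_eqI mem_cball_0)
  have "cmod (F z) \<le> A + e * \<phi> (cmod z)" for z
  proof -
    have "0 < e * \<phi> (cmod z)" using e pos by simp
    then show ?thesis using R[of z] A(1) A(2)[of z] by (cases "R \<le> cmod z") (auto simp: w_mult_le_iff)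
  qed
  then show thesis using that A(1) by (meson less_imp_le)
qed

lemma deriv_small_if_H0:
  assumes F: "F \<in> H0 w"
  shows "((\<lambda>z. cmod (deriv F z) / \<phi>' (cmod z)) \<longlongrightarrow> 0) at_infinity"
proof -
  have nonneg: "\<forall>z. r0 \<le> cmod z \<longrightarrow> 0 \<le> cmod (deriv F z) / \<phi>' (cmod z)"
    using pos' by (simp add: less_imp_le)
  obtain C where C: "0 < C"
    "\<And>F A B z. F holomorphic_on UNIV \<Longrightarrow> 0 \<le> A \<Longrightarrow> 0 \<le> B \<Longrightarrow>
       (\<And>\<zeta>. cmod (F \<zeta>) \<le> A + B * \<phi> (cmod \<zeta>)) \<Longrightarrow> r0 \<le> cmod z \<Longrightarrow>
       cmod (deriv F z) \<le> C * \<phi>' (cmod z) * (A / \<phi> (cmod z) + B)"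
    using Cauchy_estimate by blast
  show ?thesis
    unfolding tendsto_0_at_infinity_iff[OF nonneg]
  proof (intro allI impI)
    fix e :: real assume e: "0 < e"
    define B where "B = e / (2 * C)"
    have B: "0 < B" using e C by (simp add: B_def)
    obtain A where A: "0 \<le> A" "\<And>z. cmod (F z) \<le> A + B * \<phi> (cmod z)"
      using bounds_if_H0_w[OF F B] by blast
    obtain R where R: "r0 \<le> R" "\<And>r. R \<le> r \<Longrightarrow> A / B \<le> \<phi> r" using phi_eventually_ge by blast
    have "cmod (deriv F z) / \<phi>' (cmod z) \<le> e" if z: "R \<le> cmod z" for z
    proof -
      have r: "r0 \<le> cmod z" using z R by simp
      have "A / \<phi> (cmod z) \<le> B" using R(2)[OF z] B pos[of "cmod z"] by (simp add: field_simps)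
      then have "C * \<phi>' (cmod z) * (A / \<phi> (cmod z) + B) \<le> C * \<phi>' (cmod z) * (B + B)"
        using C pos'[OF r] by (intro mult_left_mono) auto
      also have "\<dots> = e * \<phi>' (cmod z)" using C by (simp add: B_def)
      finally have "cmod (deriv F z) \<le> e * \<phi>' (cmod z)"
        using C(2)[of F A B z] F A B r by (force simp: H0_def)
      then show ?thesis using pos'[OF r] by (simp add: field_simps)
    qed
    then show "\<exists>R. \<forall>z. R \<le> cmod z \<longrightarrow> cmod (deriv F z) / \<phi>' (cmod z) \<le> e" by blast
  qed
qed

text \<open>The mean value inequality in the disc, and then along the ray through \<open>z\<close>, where the derivative of
  the primitive is dominated by the derivative of \<open>e * \<phi>\<close>.\<close>

lemma volterra_bound:
  assumes f: "f holomorphic_on UNIV" and g: "g holomorphic_on UNIV"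
    and R: "r0 \<le> R" and A: "0 \<le> A" and e: "0 \<le> e"
    and inner: "\<And>\<zeta>. cmod \<zeta> \<le> R \<Longrightarrow> cmod (f \<zeta> * deriv g \<zeta>) \<le> A"
    and outer: "\<And>\<zeta>. R \<le> cmod \<zeta> \<Longrightarrow> cmod (f \<zeta> * deriv g \<zeta>) \<le> e * \<phi>' (cmod \<zeta>)"
  shows "cmod (volterra g f z) \<le> A * R + e * \<phi> (cmod z)"
proof -
  let ?V = "volterra g f"
  have R0: "0 < R" using R r0_pos by simp
  have in_disc: "cmod (?V \<zeta>) \<le> A * R" if "cmod \<zeta> \<le> R" for \<zeta>
    by (rule volterra_disc_bound[OF f g inner that])
  show ?thesis
  proof (cases "cmod z \<le> R")
    case True
    have "0 \<le> e * \<phi> (cmod z)" using e pos[of "cmod z"] by simp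
    then show ?thesis using in_disc[OF True] by linarith
  next
    case False
    define d where "d = z / of_real (cmod z)"
    have d: "cmod d = 1" "of_real (cmod z) * d = z" using False R0 by (auto simp: d_def norm_divide)
    have "cmod (?V (of_real (cmod z) * d) - ?V (of_real R * d)) \<le> e * \<phi> (cmod z) - e * \<phi> R"
    proof (rule differentiable_bound_general[where f = "\<lambda>t. ?V (of_real t * d)" and \<phi> = "\<lambda>t. e * \<phi> t"
          and f' = "\<lambda>t. (f (of_real t * d) * deriv g (of_real t * d)) * d" and \<phi>' = "\<lambda>t. e * \<phi>' t"])
      show "R < cmod z" using False by simp
      have contV: "continuous_on UNIV ?V"
        by (intro holomorphic_on_imp_continuous_on holomorphic_volterra f g)
      show "continuous_on {R..cmod z} (\<lambda>t. ?V (of_real t * d))"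
        by (rule continuous_on_compose2[OF contV]) (auto intro!: continuous_intros)
      show "continuous_on {R..cmod z} (\<lambda>t. e * \<phi> t)"
        using R by (intro continuous_intros continuous_on_subset[OF continuous_from_r0]) auto
    next
      fix t assume t: "R < t" "t < cmod z"
      have "((\<lambda>t. of_real t * d) has_vector_derivative d) (at t)"
        by (auto intro!: derivative_eq_intros simp: has_vector_derivative_def scaleR_conv_of_real)
      then show "((\<lambda>t. ?V (of_real t * d)) has_vector_derivative
          (f (of_real t * d) * deriv g (of_real t * d)) * d) (at t)"
        using field_vector_diff_chain_at[OF _ volterra_primitive(1)[OF f g], of "\<lambda>t. of_real t * d" d t]
        by (simp add: o_def mult.commute)
      show "((\<lambda>t. e * \<phi> t) has_vector_derivative e * \<phi>' t) (at t)"
        using t R by (auto intro!: derivative_eq_intros DERIV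
            simp flip: has_real_derivative_iff_has_vector_derivative)
      have "cmod (of_real t * d) = t" using t R0 d by (simp add: norm_mult)
      then show "cmod (f (of_real t * d) * deriv g (of_real t * d) * d) \<le> e * \<phi>' t"
        using outer[of "of_real t * d"] t d by (simp add: norm_mult)
    qed
    moreover have "cmod (?V (of_real R * d)) \<le> A * R"
      using d R0 by (intro in_disc) (simp add: norm_mult)
    moreover have "0 \<le> e * \<phi> R" using e pos[of R] R0 by simp
    ultimately show ?thesis
      using norm_triangle_ineq2[of "?V z" "?V (of_real R * d)"] d(2) by simp
  qed
qed

text \<open>A converse of \<open>deriv_small_if_H0\<close>: membership of a primitive in the little-o space can be read off
  from its derivative.\<close>

lemma volterra_in_H0_w:
  assumes f: "f holomorphic_on UNIV" and g: "g holomorphic_on UNIV"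
    and small: "((\<lambda>z. cmod (f z * deriv g z) / \<phi>' (cmod z)) \<longlongrightarrow> 0) at_infinity"
  shows "volterra g f \<in> H0 w"
proof (rule H0_w_if_bounds[OF holomorphic_volterra[OF f g]])
  fix e :: real assume e: "0 < e"
  have nonneg: "\<forall>z. r0 \<le> cmod z \<longrightarrow> 0 \<le> cmod (f z * deriv g z) / \<phi>' (cmod z)"
    using pos' by (simp add: less_imp_le)
  obtain R' where R': "\<And>z. R' \<le> cmod z \<Longrightarrow> cmod (f z * deriv g z) / \<phi>' (cmod z) \<le> e"
    using small e unfolding tendsto_0_at_infinity_iff[OF nonneg] by blast
  define R where "R = max r0 R'"
  have R: "r0 \<le> R" "R' \<le> R" by (auto simp: R_def)
  have "(\<lambda>\<zeta>. f \<zeta> * deriv g \<zeta>) holomorphic_on UNIV"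
    using f g by (auto intro!: holomorphic_intros)
  then have "compact ((\<lambda>\<zeta>. f \<zeta> * deriv g \<zeta>) ` cball 0 R)"
    by (intro compact_continuous_image holomorphic_on_imp_continuous_on) (auto intro: holomorphic_on_subset)
  then obtain A where A: "0 < A" "\<And>z. cmod z \<le> R \<Longrightarrow> cmod (f z * deriv g z) \<le> A"
    using compact_imp_bounded bounded_pos by (metis (mono_tags, lifting) image_eqI mem_cball_0)
  have "cmod (f z * deriv g z) \<le> e * \<phi>' (cmod z)" if "R \<le> cmod z" for z
    using R'[of z] pos'[of "cmod z"] R that by (simp add: field_simps)
  then show "\<exists>A. \<forall>z. cmod (volterra g f z) \<le> A + e * \<phi> (cmod z)"
    using volterra_bound[OF f g R(1) _ _ A(2)] A(1) e by (meson less_imp_le)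
qed

end

section \<open>Radial weights: dilations and the associated weight\<close>

locale radial_weight =
  fixes v :: "real \<Rightarrow> real"
  assumes weight: "is_weight v"
begin

abbreviation u :: "complex \<Rightarrow> real" where "u \<equiv> radial v"

lemma u_pos: "0 < u z"
  using weight by (simp add: is_weight_def radial_def)

lemma u_antimono: "cmod z \<le> cmod z' \<Longrightarrow> u z' \<le> u z"
  using weight monotone_onD[of "{0..}" "(\<le>)" "(\<ge>)" v "cmod z" "cmod z'"]
  by (simp add: is_weight_def radial_def)

lemma continuous_u: "continuous_on UNIV u"
proof -
  have "continuous_on {0..} v" using weight by (simp add: is_weight_def)
  then show ?thesis unfolding radial_def
    by (rule continuous_on_compose2) (auto intro: continuous_intros)
qed

lemma H0_subset_Hinf_u: "H0 u \<subseteq> Hinf u"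
  by (rule H0_subset_Hinf[OF u_pos continuous_u])

lemma monomial_in_H0: "(\<lambda>z. z ^ n) \<in> H0 u"
proof -
  have "((\<lambda>r. r ^ n * v r) \<longlongrightarrow> 0) at_top" using weight by (simp add: is_weight_def)
  then have "((\<lambda>z :: complex. cmod z ^ n * v (cmod z)) \<longlongrightarrow> 0) at_infinity"
    by (rule filterlim_compose[OF _ filterlim_norm_at_top])
  then show ?thesis
    by (auto simp: H0_def radial_def norm_power mult.commute intro!: holomorphic_intros)
qed

lemma polynomial_in_H0: "(\<lambda>z. \<Sum>n<N. a n * z ^ n) \<in> H0 u"
proof (induction N)
  case 0
  show ?case by (simp add: H0_def)
next
  case (Suc N)
  show ?case
    using H0_add[OF Suc H0_scale[OF monomial_in_H0, of "a N" N] u_pos] by simp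
qed

text \<open>Cauchy's inequality on the circle through \<open>z\<close>, on which the radial weight is constant.\<close>

lemma Taylor_coefficient_bound:
  assumes f: "f \<in> Hinf u"
  shows "u z * cmod ((deriv ^^ n) f 0 / fact n * z ^ n) \<le> wnorm u f"
proof (cases "z = 0")
  case True
  then show ?thesis
    using le_wnorm[OF f, of 0] wnorm_nonneg[OF f u_pos] by (cases n) auto
next
  case False
  have hol: "f holomorphic_on UNIV" using f by (simp add: Hinf_def)
  have "cmod ((deriv ^^ n) f 0) \<le> fact n * (wnorm u f / u z) / cmod z ^ n"
  proof (rule Cauchy_inequality)
    fix x assume "cmod (0 - x) = cmod z"
    then have "u x = u z" by (simp add: radial_def)
    then show "cmod (f x) \<le> wnorm u f / u z"
      using le_wnorm[OF f, of x] u_pos[of z] by (simp add: field_simps)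
  qed (use False hol in \<open>auto intro: holomorphic_on_subset continuous_on_subset
      holomorphic_on_imp_continuous_on\<close>)
  then show ?thesis
    using u_pos[of z] False by (simp add: norm_mult norm_divide norm_power field_simps)
qed

lemma dilation_in_Hinf:
  assumes f: "f \<in> Hinf u" and r: "0 < r" "r < 1"
  shows "(\<lambda>z. f (of_real r * z)) \<in> Hinf u" "wnorm u (\<lambda>z. f (of_real r * z)) \<le> wnorm u f"
proof -
  have bd: "u z * cmod (f (of_real r * z)) \<le> wnorm u f" for z
  proof -
    have "cmod (of_real r * z) \<le> cmod z" using r by (simp add: norm_mult mult_left_le_one_le)
    then have "u z * cmod (f (of_real r * z)) \<le> u (of_real r * z) * cmod (f (of_real r * z))"
      by (intro mult_right_mono u_antimono) auto
    also have "\<dots> \<le> wnorm u f" by (rule le_wnorm[OF f])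
    finally show ?thesis .
  qed
  have "(f \<circ> (\<lambda>z. of_real r * z)) holomorphic_on UNIV"
    using f by (intro holomorphic_on_compose_gen[of _ _ _ UNIV] holomorphic_intros)
      (auto simp: Hinf_def)
  then show "(\<lambda>z. f (of_real r * z)) \<in> Hinf u" using bd by (auto simp: Hinf_iff_bounded o_def)
  show "wnorm u (\<lambda>z. f (of_real r * z)) \<le> wnorm u f" by (rule wnorm_le[OF bd])
qed

text \<open>For \<open>r < 1\<close> the Taylor series of the dilate converges geometrically in the weighted norm,
  since by \<open>Taylor_coefficient_bound\<close> its \<open>n\<close>-th term has norm at most \<open>r ^ n * wnorm u f\<close>.\<close>

lemma dilation_polynomial_approximation:
  assumes f: "f \<in> Hinf u" and r: "0 < r" "r < 1" and e: "0 < e"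
  obtains N a where "\<And>z. u z * cmod (f (of_real r * z) - (\<Sum>n<N. a n * z ^ n)) \<le> e"
proof -
  have hol: "f holomorphic_on ball 0 R" for R
    using f holomorphic_on_subset[of f UNIV "ball 0 R"] by (simp add: Hinf_def)
  define a where "a n = (deriv ^^ n) f 0 / fact n * of_real r ^ n" for n
  have "(\<lambda>n. wnorm u f / (1 - r) * r ^ n) \<longlonglongrightarrow> 0"
    using r by (intro tendsto_mult_right_zero LIMSEQ_power_zero) simp
  then have "\<forall>\<^sub>F n in sequentially. wnorm u f / (1 - r) * r ^ n < e"
    using e by (rule order_tendstoD(2))
  then obtain N where N: "wnorm u f * r ^ N / (1 - r) < e"
    unfolding eventually_sequentially by force
  have "u z * cmod (f (of_real r * z) - (\<Sum>n<N. a n * z ^ n)) \<le> e" for z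
  proof -
    have "(\<lambda>n. (deriv ^^ n) f 0 / fact n * (of_real r * z - 0) ^ n) sums f (of_real r * z)"
      by (rule holomorphic_power_series[OF hol[of "cmod (of_real r * z) + 1"]]) simp
    then have "(\<lambda>n. a n * z ^ n) sums f (of_real r * z)"
      by (simp add: a_def power_mult_distrib mult.assoc)
    then have "(\<lambda>n. a (n + N) * z ^ (n + N)) sums (f (of_real r * z) - (\<Sum>n<N. a n * z ^ n))"
      by (rule sums_split_initial_segment)
    then have tail: "(\<lambda>n. of_real (u z) * (a (n + N) * z ^ (n + N))) sums
        (of_real (u z) * (f (of_real r * z) - (\<Sum>n<N. a n * z ^ n)))"
      by (rule sums_mult)
    have "(\<lambda>n. wnorm u f * r ^ N * r ^ n) sums (wnorm u f * r ^ N * (1 / (1 - r)))"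
      using r by (intro sums_mult geometric_sums) auto
    then have geo: "(\<lambda>n. wnorm u f * r ^ (n + N)) sums (wnorm u f * r ^ N / (1 - r))"
      by (simp add: power_add mult_ac)
    have "cmod (of_real (u z) * (f (of_real r * z) - (\<Sum>n<N. a n * z ^ n))) \<le> wnorm u f * r ^ N / (1 - r)"
    proof (rule norm_sums_le[OF tail geo])
      fix n
      have "cmod (of_real (u z) * (a (n + N) * z ^ (n + N))) =
          (u z * cmod ((deriv ^^ (n + N)) f 0 / fact (n + N) * z ^ (n + N))) * r ^ (n + N)"
        using u_pos[of z] r by (simp add: a_def norm_mult norm_divide norm_power)
      also have "\<dots> \<le> wnorm u f * r ^ (n + N)"
        using r by (intro mult_right_mono Taylor_coefficient_bound f) auto
      finally show "cmod (of_real (u z) * (a (n + N) * z ^ (n + N))) \<le> wnorm u f * r ^ (n + N)" .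
    qed
    then show ?thesis using N u_pos[of z] by (simp add: norm_mult)
  qed
  then show thesis by (rule that)
qed

text \<open>Dilates serve as bounded approximations of functions in the big-O space by functions in the
  little-o space.\<close>

lemma dilation_in_H0:
  assumes f: "f \<in> Hinf u" and r: "0 < r" "r < 1"
  shows "(\<lambda>z. f (of_real r * z)) \<in> H0 u"
  unfolding H0_iff_small[OF u_pos]
proof (intro conjI allI impI)
  show "(\<lambda>z. f (of_real r * z)) holomorphic_on UNIV"
    using dilation_in_Hinf(1)[OF f r] by (simp add: Hinf_def)
  fix e :: real assume "0 < e"
  then have e: "0 < e / 2" by simp
  obtain N a where app: "\<And>z. u z * cmod (f (of_real r * z) - (\<Sum>n<N. a n * z ^ n)) \<le> e / 2"
    using dilation_polynomial_approximation[OF f r e] by blast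
  obtain R where R: "\<And>z. R \<le> cmod z \<Longrightarrow> u z * cmod (\<Sum>n<N. a n * z ^ n) \<le> e / 2"
    using polynomial_in_H0[of a N] e unfolding H0_iff_small[OF u_pos] by blast
  have "u z * cmod (f (of_real r * z)) \<le> e" if "R \<le> cmod z" for z
  proof -
    have "cmod (f (of_real r * z)) \<le>
        cmod (f (of_real r * z) - (\<Sum>n<N. a n * z ^ n)) + cmod (\<Sum>n<N. a n * z ^ n)"
      using norm_triangle_ineq[of "f (of_real r * z) - (\<Sum>n<N. a n * z ^ n)" "\<Sum>n<N. a n * z ^ n"] by simp
    then have "u z * cmod (f (of_real r * z)) \<le>
        u z * cmod (f (of_real r * z) - (\<Sum>n<N. a n * z ^ n)) + u z * cmod (\<Sum>n<N. a n * z ^ n)"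
      using u_pos[of z] by (simp flip: distrib_left)
    then show ?thesis using app[of z] R[OF that] by linarith
  qed
  then show "\<exists>R. \<forall>z. R \<le> cmod z \<longrightarrow> u z * cmod (f (of_real r * z)) \<le> e" by blast
qed

abbreviation u' :: "complex \<Rightarrow> real" where "u' \<equiv> assoc_weight u"

text \<open>The supremum defining the associated weight is finite, being bounded by \<open>1 / u\<close>, and positive,
  since suitable constants lie in the unit ball; the homogeneous estimate then follows by scaling.\<close>

lemma assoc_weight_props:
  shows assoc_weight_pos: "0 < u' z"
    and le_assoc_weight: "u z \<le> u' z"
    and assoc_weight_le_wnorm: "f \<in> Hinf u \<Longrightarrow> u' z * cmod (f z) \<le> wnorm u f"
    and ex_almost_extremal: "\<exists>f\<in>Hinf u. wnorm u f \<le> 1 \<and> 1 < 2 * u' z * cmod (f z)"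
proof -
  define S where "S = {cmod (f z) | f. f \<in> Hinf u \<and> wnorm u f \<le> 1}"
  have u': "u' z = inverse (Sup S)" by (simp add: assoc_weight_def S_def)
  have ub: "x \<le> 1 / u z" if x: "x \<in> S" for x
  proof -
    obtain f where f: "x = cmod (f z)" "f \<in> Hinf u" "wnorm u f \<le> 1" using x by (auto simp: S_def)
    have "u z * x \<le> 1" using le_wnorm[OF f(2), of z] f by simp
    then show ?thesis using u_pos[of z] by (simp add: field_simps)
  qed
  then have bdd: "bdd_above S" by (auto simp: bdd_above_def)
  define c where "c = complex_of_real (1 / u 0)"
  have c: "u \<zeta> * cmod c \<le> 1" for \<zeta>
    using u_antimono[of 0 \<zeta>] u_pos[of 0] u_pos[of \<zeta>] by (simp add: c_def norm_divide)
  then have "(\<lambda>_. c) \<in> Hinf u" "wnorm u (\<lambda>_. c) \<le> 1"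
    by (auto simp: Hinf_iff_bounded intro: wnorm_le)
  then have cS: "cmod c \<in> S" by (auto simp: S_def)
  have "0 < cmod c" using u_pos[of 0] by (simp add: c_def norm_divide)
  moreover have "cmod c \<le> Sup S" by (rule cSup_upper[OF cS bdd])
  ultimately have Sup_pos: "0 < Sup S" by linarith
  then show pos: "0 < u' z" by (simp add: u')
  have "Sup S \<le> 1 / u z" using cS ub by (intro cSup_least) auto
  then show "u z \<le> u' z" using Sup_pos u_pos[of z] by (simp add: u' field_simps)
  show "\<exists>f\<in>Hinf u. wnorm u f \<le> 1 \<and> 1 < 2 * u' z * cmod (f z)"
  proof -
    have "Sup S / 2 < Sup S" using Sup_pos by simp
    then obtain x where "x \<in> S" "Sup S / 2 < x" using less_cSup_iff[OF _ bdd] cS by blast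
    then show ?thesis using Sup_pos by (auto simp: S_def u' field_simps)
  qed
  show "u' z * cmod (f z) \<le> wnorm u f" if f: "f \<in> Hinf u"
  proof (rule field_le_epsilon)
    fix e :: real assume e: "0 < e"
    \<comment> \<open>The summand \<open>e\<close> makes division by \<open>k\<close> possible even if the norm is \<open>0\<close>.\<close>
    define k where "k = wnorm u f + e"
    have k: "0 < k" "wnorm u f \<le> k"
      using wnorm_nonneg[OF f u_pos] e by (simp_all add: k_def add_nonneg_pos)
    have "wnorm u (\<lambda>\<zeta>. of_real (1 / k) * f \<zeta>) \<le> 1 / k * wnorm u f"
      using wnorm_scale_le[OF f, of "of_real (1 / k)"] k by (simp add: norm_divide)
    also have "\<dots> \<le> 1" using k by (simp add: field_simps)
    finally have "cmod (of_real (1 / k) * f z) \<in> S"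
      using Hinf_scale[OF f, of "of_real (1 / k)"] unfolding S_def
      by (intro CollectI exI[of _ "\<lambda>\<zeta>. of_real (1 / k) * f \<zeta>"]) auto
    then have "cmod (of_real (1 / k) * f z) \<le> Sup S" by (rule cSup_upper[OF _ bdd])
    then have "u' z * cmod (f z) \<le> k" using k Sup_pos by (simp add: u' norm_divide field_simps)
    then show "u' z * cmod (f z) \<le> wnorm u f + e" by (simp add: k_def)
  qed
qed

end

section \<open>Compactness and weak compactness of the Volterra operator\<close>

locale volterra_setting = growth_function \<phi> \<phi>' \<phi>'' r0 + radial_weight v
  for \<phi> \<phi>' \<phi>'' :: "real \<Rightarrow> real" and r0 :: real and v :: "real \<Rightarrow> real" +
  fixes g :: "complex \<Rightarrow> complex"
  assumes g: "g holomorphic_on UNIV"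
begin

text \<open>The quotient of \<open>C3\<close>, which bounds \<open>f * g'\<close> relative to \<open>\<phi>'\<close> over the unit ball.  The
  implications below allow any source \<open>X\<close> and target \<open>Y\<close> satisfying suitable inclusions with the
  little-o and big-O spaces, so that each covers both pairs of spaces at once.\<close>

abbreviation symbol_quotient :: "complex \<Rightarrow> real" where
  "symbol_quotient z \<equiv> cmod (deriv g z) / (\<phi>' (cmod z) * u' z)"

lemma symbol_quotient_nonneg: "\<forall>z. r0 \<le> cmod z \<longrightarrow> 0 \<le> symbol_quotient z"
  using pos' assoc_weight_pos by (simp add: less_imp_le)

text \<open>Smallness of the symbol quotient means \<open>|f * g'| \<le> e * \<phi>' * u' * |f| \<le> e * \<phi>' * wnorm u f\<close> far out, so
  the primitive is at most \<open>e * \<phi>\<close>, up to a constant, uniformly over the unit ball.\<close>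

lemma uniform_growth_bound:
  assumes small: "(symbol_quotient \<longlongrightarrow> 0) at_infinity" and e: "0 < e"
  obtains A where "0 \<le> A"
    "\<And>f z. f \<in> Hinf u \<Longrightarrow> cmod (volterra g f z) \<le> (A + e * \<phi> (cmod z)) * wnorm u f"
proof -
  obtain R' where R': "\<And>z. R' \<le> cmod z \<Longrightarrow> symbol_quotient z \<le> e"
    using small e unfolding tendsto_0_at_infinity_iff[OF symbol_quotient_nonneg] by blast
  define R where "R = max r0 R'"
  have R: "r0 \<le> R" "R' \<le> R" "0 < R" using r0_pos by (auto simp: R_def)
  have "compact (deriv g ` cball 0 R)"
    using holomorphic_deriv[OF g open_UNIV]
    by (intro compact_continuous_image holomorphic_on_imp_continuous_on) (auto intro: holomorphic_on_subset)
  then obtain G where G: "0 < G" "\<And>z. cmod z \<le> R \<Longrightarrow> cmod (deriv g z) \<le> G"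
    using compact_imp_bounded bounded_pos by (metis (mono_tags, lifting) image_eqI mem_cball_0)
  define A where "A = G / v R"
  have vR: "v R = u (of_real R)" using R by (simp add: radial_def)
  have A: "0 \<le> A" using G u_pos[of "of_real R"] by (simp add: A_def vR)
  show thesis
  proof (rule that)
    show "0 \<le> A * R" using A R by simp
    fix f z assume f: "f \<in> Hinf u"
    have hol: "f holomorphic_on UNIV" using f by (simp add: Hinf_def)
    have nn: "0 \<le> wnorm u f" by (rule wnorm_nonneg[OF f u_pos])
    have "cmod (volterra g f z) \<le> A * wnorm u f * R + e * wnorm u f * \<phi> (cmod z)"
    proof (rule volterra_bound[OF hol g R(1)])
      show "0 \<le> A * wnorm u f" "0 \<le> e * wnorm u f" using A nn e by auto
    next
      fix \<zeta> assume \<zeta>: "cmod \<zeta> \<le> R"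
      have "v R * cmod (f \<zeta>) \<le> u \<zeta> * cmod (f \<zeta>)"
        unfolding vR using \<zeta> R by (intro mult_right_mono u_antimono) auto
      also have "\<dots> \<le> wnorm u f" by (rule le_wnorm[OF f])
      finally have "cmod (f \<zeta>) \<le> wnorm u f / v R"
        using u_pos[of "of_real R"] by (simp add: vR field_simps)
      then have "cmod (f \<zeta>) * cmod (deriv g \<zeta>) \<le> wnorm u f / v R * G"
        using G \<zeta> nn u_pos[of "of_real R"] by (intro mult_mono) (auto simp: vR)
      then show "cmod (f \<zeta> * deriv g \<zeta>) \<le> A * wnorm u f" by (simp add: A_def norm_mult mult_ac)
    next
      fix \<zeta> assume \<zeta>: "R \<le> cmod \<zeta>"
      have p: "0 < \<phi>' (cmod \<zeta>)" "0 < u' \<zeta>" using pos'[of "cmod \<zeta>"] \<zeta> R assoc_weight_pos by auto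
      have "cmod (deriv g \<zeta>) \<le> e * (\<phi>' (cmod \<zeta>) * u' \<zeta>)"
        using R'[of \<zeta>] \<zeta> R p by (simp add: field_simps)
      then have "cmod (f \<zeta> * deriv g \<zeta>) \<le> cmod (f \<zeta>) * (e * (\<phi>' (cmod \<zeta>) * u' \<zeta>))"
        by (simp add: norm_mult mult_left_mono)
      also have "\<dots> = e * \<phi>' (cmod \<zeta>) * (u' \<zeta> * cmod (f \<zeta>))" by simp
      also have "\<dots> \<le> e * \<phi>' (cmod \<zeta>) * wnorm u f"
        using e p by (intro mult_left_mono assoc_weight_le_wnorm f) auto
      finally show "cmod (f \<zeta> * deriv g \<zeta>) \<le> e * wnorm u f * \<phi>' (cmod \<zeta>)" by (simp add: mult_ac)
    qed
    then show "cmod (volterra g f z) \<le> (A * R + e * \<phi> (cmod z)) * wnorm u f"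
      by (simp add: algebra_simps)
  qed
qed

lemma compact_operator_if_symbol_small:
  assumes small: "(symbol_quotient \<longlongrightarrow> 0) at_infinity"
    and X: "X \<subseteq> Hinf u" and Y: "H0 w \<subseteq> Y" "Y \<subseteq> Hinf w"
  shows "compact_operator X (wnorm u) Y (wnorm w) (volterra g)"
proof -
  have hol: "f holomorphic_on UNIV" if "f \<in> X" for f using that X by (auto simp: Hinf_def)
  have nn: "0 \<le> wnorm u f" if "f \<in> X" for f using wnorm_nonneg[of f u] u_pos that X by blast
  have into_H0: "volterra g f \<in> H0 w" if f: "f \<in> X" for f
  proof (rule H0_w_if_bounds[OF holomorphic_volterra[OF hol[OF f] g]])
    fix e :: real assume e: "0 < e"
    define k where "k = wnorm u f + 1"
    have k: "0 < k" "wnorm u f \<le> k" using nn[OF f] by (auto simp: k_def)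
    obtain A where A: "0 \<le> A"
      "\<And>f z. f \<in> Hinf u \<Longrightarrow> cmod (volterra g f z) \<le> (A + e / k * \<phi> (cmod z)) * wnorm u f"
      using uniform_growth_bound[OF small, of "e / k"] e k by auto
    have "cmod (volterra g f z) \<le> A * k + e * \<phi> (cmod z)" for z
    proof -
      have "cmod (volterra g f z) \<le> (A + e / k * \<phi> (cmod z)) * wnorm u f"
        using A(2) X f by blast
      also have "\<dots> \<le> (A + e / k * \<phi> (cmod z)) * k"
        using A(1) e k pos[of "cmod z"] by (intro mult_left_mono) auto
      also have "\<dots> = A * k + e * \<phi> (cmod z)" using k by (simp add: field_simps)
      finally show ?thesis .
    qed
    then show "\<exists>A. \<forall>z. cmod (volterra g f z) \<le> A + e * \<phi> (cmod z)" by blast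
  qed
  obtain A where A: "0 \<le> A"
    "\<And>f z. f \<in> Hinf u \<Longrightarrow> cmod (volterra g f z) \<le> (A + 1 * \<phi> (cmod z)) * wnorm u f"
    using uniform_growth_bound[OF small, of 1] by auto
  have "wnorm w (volterra g f) \<le> (A / \<phi> 0 + 1) * wnorm u f" if f: "f \<in> X" for f
  proof (rule wnorm_le)
    fix z
    have "A * \<phi> 0 \<le> A * \<phi> (cmod z)" using A(1) mono_onD[OF mono, of 0 "cmod z"] by (simp add: mult_left_mono)
    then have "A + 1 * \<phi> (cmod z) \<le> (A / \<phi> 0 + 1) * \<phi> (cmod z)"
      using pos[of 0] by (simp add: field_simps)
    then have "(A + 1 * \<phi> (cmod z)) * wnorm u f \<le> (A / \<phi> 0 + 1) * \<phi> (cmod z) * wnorm u f"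
      using nn[OF f] by (rule mult_right_mono)
    then show "w z * cmod (volterra g f z) \<le> (A / \<phi> 0 + 1) * wnorm u f"
      using A(2)[of f z] f X unfolding w_mult_le_iff by (auto simp: mult_ac)
  qed
  then have "bounded_operator X (wnorm u) Y (wnorm w) (volterra g)"
    unfolding bounded_operator_def
    by (intro conjI ballI allI exI[of _ "A / \<phi> 0 + 1"] volterra_add volterra_scale g hol
        subsetD[OF Y(1)] into_H0)
  moreover have "relatively_compactin (norm_topology Y (wnorm w)) (volterra g ` {f \<in> X. wnorm u f \<le> 1})"
  proof (rule relatively_compact_if_uniformly_small_at_infinity[OF w_pos continuous_w Y])
    let ?S = "volterra g ` {f \<in> X. wnorm u f \<le> 1}"
    show "?S \<subseteq> H0 w" using into_H0 by blast
    have ball: "cmod (volterra g f z) \<le> A + e * \<phi> (cmod z)"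
      if "f \<in> X" "wnorm u f \<le> 1" "0 \<le> A" "0 < e"
        "\<And>f z. f \<in> Hinf u \<Longrightarrow> cmod (volterra g f z) \<le> (A + e * \<phi> (cmod z)) * wnorm u f" for f A e z
    proof -
      have "cmod (volterra g f z) \<le> (A + e * \<phi> (cmod z)) * wnorm u f" using that X by blast
      also have "\<dots> \<le> (A + e * \<phi> (cmod z)) * 1"
        using that pos[of "cmod z"] by (intro mult_left_mono) auto
      finally show ?thesis by simp
    qed
    show "\<exists>B. \<forall>F\<in>?S. \<forall>z. cmod z \<le> R \<longrightarrow> cmod (F z) \<le> B" for R
    proof -
      have "cmod (volterra g f z) \<le> A + 1 * \<phi> (max R 0)"
        if "f \<in> X" "wnorm u f \<le> 1" "cmod z \<le> R" for f z
      proof -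
        have "cmod z \<le> max R 0" using that(3) by simp
        then show ?thesis
          using ball[OF that(1,2) A(1) _ A(2), of z] mono_onD[OF mono, of "cmod z" "max R 0"] by simp
      qed
      then show ?thesis by blast
    qed
    show "\<exists>R. \<forall>F\<in>?S. \<forall>z. R \<le> cmod z \<longrightarrow> w z * cmod (F z) \<le> e" if e: "0 < e" for e
    proof -
      obtain B where B: "0 \<le> B"
        "\<And>f z. f \<in> Hinf u \<Longrightarrow> cmod (volterra g f z) \<le> (B + e / 2 * \<phi> (cmod z)) * wnorm u f"
        using uniform_growth_bound[OF small, of "e / 2"] e by auto
      obtain R where R: "\<And>r. R \<le> r \<Longrightarrow> B / (e / 2) \<le> \<phi> r" using phi_eventually_ge by blast
      have "w z * cmod (volterra g f z) \<le> e"
        if "f \<in> X" "wnorm u f \<le> 1" "R \<le> cmod z" for f z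
      proof -
        have "B \<le> e / 2 * \<phi> (cmod z)" using R[OF that(3)] e by (simp add: field_simps)
        then show ?thesis
          using ball[OF that(1,2) B(1) _ B(2), of z] e unfolding w_mult_le_iff by simp
      qed
      then show ?thesis by blast
    qed
  qed
  ultimately show ?thesis by (simp add: compact_operator_def)
qed

text \<open>The function \<open>f * g'\<close> is the derivative of the image of \<open>f\<close>, to which the derivative estimate in
  the target space applies.\<close>

lemma symbol_bound_if_bounded_operator:
  assumes T: "bounded_operator X (wnorm u) Y (wnorm w) (volterra g)"
    and X: "X \<subseteq> Hinf u" and Y: "Y \<subseteq> Hinf w"
  obtains C where "0 < C"
    "\<And>f z. f \<in> X \<Longrightarrow> r0 \<le> cmod z \<Longrightarrow> cmod (f z * deriv g z) \<le> C * \<phi>' (cmod z) * wnorm u f"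
proof -
  obtain C where C: "0 < C"
    "\<And>F z. F \<in> Hinf w \<Longrightarrow> r0 \<le> cmod z \<Longrightarrow> cmod (deriv F z) \<le> C * \<phi>' (cmod z) * wnorm w F"
    using deriv_bound_Hinf by blast
  obtain K where K: "\<And>f. f \<in> X \<Longrightarrow> wnorm w (volterra g f) \<le> K * wnorm u f"
    and TY: "\<And>f. f \<in> X \<Longrightarrow> volterra g f \<in> Y"
    using T unfolding bounded_operator_def by blast
  show thesis
  proof (rule that)
    show "0 < C * max K 1" using C by simp
    fix f z assume f: "f \<in> X" and z: "r0 \<le> cmod z"
    have "f holomorphic_on UNIV" using f X by (auto simp: Hinf_def)
    then have "cmod (f z * deriv g z) = cmod (deriv (volterra g f) z)" by (simp add: deriv_volterra g)
    also have "\<dots> \<le> C * \<phi>' (cmod z) * wnorm w (volterra g f)" using C(2)[OF _ z] TY[OF f] Y by blast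
    also have "\<dots> \<le> C * \<phi>' (cmod z) * (max K 1 * wnorm u f)"
    proof (rule mult_left_mono)
      have "0 \<le> wnorm u f" using wnorm_nonneg[of f u] u_pos f X by blast
      then have "K * wnorm u f \<le> max K 1 * wnorm u f" by (intro mult_right_mono) auto
      then show "wnorm w (volterra g f) \<le> max K 1 * wnorm u f" using K[OF f] by linarith
    qed (use C pos'[OF z] in auto)
    finally show "cmod (f z * deriv g z) \<le> C * max K 1 * \<phi>' (cmod z) * wnorm u f" by (simp add: mult_ac)
  qed
qed

text \<open>Boundedness alone already forces the images of polynomials into the little-o space: applied to
  \<open>z * p\<close>, the symbol bound gains a factor \<open>1 / |z|\<close> for \<open>p\<close>.  Dilates are norm limits of
  polynomials, so their images inherit the property.\<close>

lemma volterra_dilation_in_H0: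
  assumes T: "bounded_operator X (wnorm u) Y (wnorm w) (volterra g)"
    and X: "H0 u \<subseteq> X" "X \<subseteq> Hinf u" and Y: "Y \<subseteq> Hinf w"
    and f: "f \<in> Hinf u" and r: "0 < r" "r < 1"
  shows "volterra g (\<lambda>z. f (of_real r * z)) \<in> H0 w"
proof (rule volterra_in_H0_w[OF _ g])
  obtain C where C: "0 < C"
    "\<And>f z. f \<in> X \<Longrightarrow> r0 \<le> cmod z \<Longrightarrow> cmod (f z * deriv g z) \<le> C * \<phi>' (cmod z) * wnorm u f"
    using symbol_bound_if_bounded_operator[OF T X(2) Y] by blast
  let ?f = "\<lambda>z. f (of_real r * z)"
  have fX: "?f \<in> X" using dilation_in_H0[OF f r] X by blast
  then show "?f holomorphic_on UNIV" using X by (auto simp: Hinf_def)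
  have poly: "((\<lambda>z. cmod ((\<Sum>n<N. a n * z ^ n) * deriv g z) / \<phi>' (cmod z)) \<longlongrightarrow> 0) at_infinity" for N a
  proof -
    let ?p = "\<lambda>z. z * (\<Sum>n<N. a n * z ^ n)"
    have "?p \<in> H0 u"
    proof -
      have "?p = (\<lambda>z. \<Sum>n<Suc N. (case n of 0 \<Rightarrow> 0 | Suc m \<Rightarrow> a m) * z ^ n)"
        by (auto simp: sum.lessThan_Suc_shift sum_distrib_left mult_ac simp del: sum.lessThan_Suc)
      then show ?thesis using polynomial_in_H0 by metis
    qed
    then have p: "cmod (?p z * deriv g z) \<le> C * \<phi>' (cmod z) * wnorm u ?p" if "r0 \<le> cmod z" for z
      using C(2)[OF _ that] X by blast
    show ?thesis
    proof (rule Lim_null_comparison)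
      show "((\<lambda>z :: complex. C * wnorm u ?p / cmod z) \<longlongrightarrow> 0) at_infinity"
        by (rule tendsto_divide_0[OF tendsto_const]) (simp add: filterlim_norm_at_top filterlim_at_top_imp_at_infinity)
      have "norm (cmod ((\<Sum>n<N. a n * z ^ n) * deriv g z) / \<phi>' (cmod z)) \<le> C * wnorm u ?p / cmod z"
        if z: "r0 \<le> cmod z" for z
      proof -
        have "0 < cmod z" using z r0_pos by linarith
        then show ?thesis using p[OF z] pos'[OF z] by (simp add: norm_mult field_simps)
      qed
      then show "\<forall>\<^sub>F z in at_infinity. norm (cmod ((\<Sum>n<N. a n * z ^ n) * deriv g z) / \<phi>' (cmod z))
          \<le> C * wnorm u ?p / cmod z"
        unfolding eventually_at_infinity by blast
    qed
  qed
  have nonneg: "\<forall>z. r0 \<le> cmod z \<longrightarrow> 0 \<le> cmod (h z * deriv g z) / \<phi>' (cmod z)" for h :: "complex \<Rightarrow> complex"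
    using pos' by (simp add: less_imp_le)
  show "((\<lambda>z. cmod (?f z * deriv g z) / \<phi>' (cmod z)) \<longlongrightarrow> 0) at_infinity"
    unfolding tendsto_0_at_infinity_iff[OF nonneg]
  proof (intro allI impI)
    fix e :: real assume e: "0 < e"
    have eC: "0 < e / (2 * C)" using e C(1) by simp
    obtain N a where app: "\<And>z. u z * cmod (?f z - (\<Sum>n<N. a n * z ^ n)) \<le> e / (2 * C)"
      using dilation_polynomial_approximation[OF f r eC] by blast
    let ?p = "\<lambda>z. \<Sum>n<N. a n * z ^ n"
    have "(\<lambda>z. ?f z - ?p z) \<in> H0 u" by (intro H0_diff dilation_in_H0 f r polynomial_in_H0 u_pos)
    then have dX: "(\<lambda>z. ?f z - ?p z) \<in> X" using X by blast
    have wn: "wnorm u (\<lambda>z. ?f z - ?p z) \<le> e / (2 * C)" by (rule wnorm_le[OF app])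
    have "0 < e / 2" using e by simp
    then obtain R where R: "\<And>z. R \<le> cmod z \<Longrightarrow> cmod (?p z * deriv g z) / \<phi>' (cmod z) \<le> e / 2"
      using poly[where N = N and a = a] unfolding tendsto_0_at_infinity_iff[OF nonneg] by blast
    have "cmod (?f z * deriv g z) / \<phi>' (cmod z) \<le> e" if z: "max r0 R \<le> cmod z" for z
    proof -
      have z: "r0 \<le> cmod z" "R \<le> cmod z" using z by auto
      have "cmod ((?f z - ?p z) * deriv g z) \<le> C * \<phi>' (cmod z) * wnorm u (\<lambda>z. ?f z - ?p z)"
        by (rule C(2)[OF dX z(1)])
      also have "\<dots> \<le> C * \<phi>' (cmod z) * (e / (2 * C))"
        using C pos'[OF z(1)] wn by (intro mult_left_mono) auto
      also have "\<dots> = e / 2 * \<phi>' (cmod z)" using C by simp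
      finally have 1: "cmod ((?f z - ?p z) * deriv g z) \<le> e / 2 * \<phi>' (cmod z)" .
      have 2: "cmod (?p z * deriv g z) \<le> e / 2 * \<phi>' (cmod z)"
        using R[OF z(2)] pos'[OF z(1)] by (simp add: field_simps)
      have "cmod (?f z * deriv g z) \<le> cmod ((?f z - ?p z) * deriv g z) + cmod (?p z * deriv g z)"
        using norm_triangle_ineq[of "(?f z - ?p z) * deriv g z" "?p z * deriv g z"] by (simp add: algebra_simps)
      then have "cmod (?f z * deriv g z) \<le> e * \<phi>' (cmod z)" using 1 2 by simp
      then show ?thesis using pos'[OF z(1)] by (simp add: field_simps)
    qed
    then show "\<exists>R. \<forall>z. R \<le> cmod z \<longrightarrow> cmod (?f z * deriv g z) / \<phi>' (cmod z) \<le> e" by blast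
  qed
qed

text \<open>By total boundedness the images of all dilates of functions in the unit ball are close to finitely
  many functions \<open>F\<close> in the little-o space.  For these \<open>F'\<close> is \<open>o(\<phi>')\<close>, hence \<open>h * g'\<close> is small relative
  to \<open>\<phi>'\<close>, uniformly over the dilates \<open>h\<close>.  Letting the dilation parameter tend to \<open>1\<close> at an almost
  extremal function for the point \<open>z\<close> replaces \<open>|h z|\<close> by \<open>1 / u' z\<close>, up to a factor \<open>2\<close>.\<close>

lemma symbol_small_if_compact_operator:
  assumes T: "compact_operator X (wnorm u) Y (wnorm w) (volterra g)"
    and X: "H0 u \<subseteq> X" "X \<subseteq> Hinf u" and Y: "Y \<subseteq> Hinf w"
  shows "(symbol_quotient \<longlongrightarrow> 0) at_infinity"
  unfolding tendsto_0_at_infinity_iff[OF symbol_quotient_nonneg]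
proof (intro allI impI)
  fix e :: real assume e: "0 < e"
  interpret Y: Metric_space Y "norm_dist Y (wnorm w)"
    by (rule Metric_space_norm_dist[OF w_pos Y])
  have B: "bounded_operator X (wnorm u) Y (wnorm w) (volterra g)"
    using T by (simp add: compact_operator_def)
  define D where "D = {(\<lambda>z. f (complex_of_real r * z)) | f r. f \<in> Hinf u \<and> wnorm u f \<le> 1 \<and> 0 < r \<and> r < 1}"
  have D: "h \<in> X" "wnorm u h \<le> 1" "volterra g h \<in> H0 w" if hD: "h \<in> D" for h
  proof -
    obtain f r where h: "h = (\<lambda>z. f (complex_of_real r * z))" and f: "f \<in> Hinf u" "wnorm u f \<le> 1"
      and r: "0 < r" "r < 1"
      using hD by (auto simp: D_def)
    show "h \<in> X" "wnorm u h \<le> 1" "volterra g h \<in> H0 w"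
      using dilation_in_H0[OF f(1) r] dilation_in_Hinf(2)[OF f(1) r] f X
        volterra_dilation_in_H0[OF B X Y f(1) r] by (auto simp: h)
  qed
  have "Y.mtotally_bounded (volterra g ` {f \<in> X. wnorm u f \<le> 1})"
    using T unfolding compact_operator_def relatively_compactin_def norm_topology_def
    by (intro Y.compact_closure_of_imp_mtotally_bounded) auto
  then have tb: "Y.mtotally_bounded (volterra g ` D)"
    by (rule Y.mtotally_bounded_subset) (use D in auto)
  obtain C where C: "0 < C"
    "\<And>F z. F \<in> Hinf w \<Longrightarrow> r0 \<le> cmod z \<Longrightarrow> cmod (deriv F z) \<le> C * \<phi>' (cmod z) * wnorm w F"
    using deriv_bound_Hinf by blast
  have eC: "0 < e / (4 * C)" using e C by simp
  obtain K where K: "finite K" "K \<subseteq> volterra g ` D"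
    "volterra g ` D \<subseteq> (\<Union>F\<in>K. Y.mball F (e / (4 * C)))"
    using tb[unfolded Y.mtotally_bounded_def, rule_format, OF eC] by (elim exE conjE)
  have "\<forall>\<^sub>F z in at_infinity. \<forall>F\<in>K. cmod (deriv F z) / \<phi>' (cmod z) < e / 4"
  proof (rule eventually_ball_finite[OF K(1)], rule ballI)
    fix F assume "F \<in> K"
    then have "F \<in> H0 w" using K(2) D by blast
    then show "\<forall>\<^sub>F z in at_infinity. cmod (deriv F z) / \<phi>' (cmod z) < e / 4"
      using e by (intro order_tendstoD(2)[OF deriv_small_if_H0]) auto
  qed
  then obtain R where R: "\<And>F z. R \<le> cmod z \<Longrightarrow> F \<in> K \<Longrightarrow> cmod (deriv F z) / \<phi>' (cmod z) < e / 4"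
    unfolding eventually_at_infinity by blast
  have D_small: "cmod (h z * deriv g z) \<le> e / 2 * \<phi>' (cmod z)"
    if z: "r0 \<le> cmod z" "R \<le> cmod z" and h: "h \<in> D" for h z
  proof -
    obtain F where F: "F \<in> K" "volterra g h \<in> Y.mball F (e / (4 * C))" using K(3) h by blast
    let ?H = "volterra g h"
    have FH: "F \<in> Y" "?H \<in> Y" "wnorm w (\<lambda>z. F z - ?H z) < e / (4 * C)"
      using F(2) by (auto simp: Y.in_mball norm_dist_def)
    have hol: "F holomorphic_on UNIV" "?H holomorphic_on UNIV" using FH Y by (auto simp: Hinf_def)
    have "deriv (\<lambda>z. F z - ?H z) z = deriv F z - deriv ?H z"
      using hol by (intro deriv_diff) (auto simp: holomorphic_on_def)
    moreover have "cmod (deriv (\<lambda>z. F z - ?H z) z) \<le> C * \<phi>' (cmod z) * wnorm w (\<lambda>z. F z - ?H z)"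
      using FH Y by (intro C(2)[OF _ z(1)] Hinf_diff w_pos) auto
    moreover have "\<dots> \<le> C * \<phi>' (cmod z) * (e / (4 * C))"
      using FH C pos'[OF z(1)] by (intro mult_left_mono) auto
    moreover have "C * \<phi>' (cmod z) * (e / (4 * C)) = e / 4 * \<phi>' (cmod z)" using C by simp
    moreover have "cmod (deriv F z) \<le> e / 4 * \<phi>' (cmod z)"
      using R[OF z(2) F(1)] pos'[OF z(1)] by (simp add: field_simps)
    moreover have "cmod (deriv ?H z) \<le> cmod (deriv F z) + cmod (deriv F z - deriv ?H z)"
      using norm_triangle_ineq4[of "deriv F z" "deriv F z - deriv ?H z"] by simp
    ultimately have "cmod (deriv ?H z) \<le> e / 2 * \<phi>' (cmod z)" by simp
    moreover have "deriv ?H z = h z * deriv g z"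
      using D(1)[OF h] X by (intro deriv_volterra g) (auto simp: Hinf_def)
    ultimately show ?thesis by simp
  qed
  have "symbol_quotient z \<le> e" if "max r0 R \<le> cmod z" for z
  proof -
    have z: "r0 \<le> cmod z" "R \<le> cmod z" using that by auto
    obtain f where f: "f \<in> Hinf u" "wnorm u f \<le> 1" "1 < 2 * u' z * cmod (f z)"
      using ex_almost_extremal by blast
    define r where "r n = real (Suc n) / real (Suc (Suc n))" for n
    have r: "0 < r n" "r n < 1" for n by (auto simp: r_def)
    have "r \<longlonglongrightarrow> 1" unfolding r_def by (rule LIMSEQ_Suc[OF LIMSEQ_n_over_Suc_n])
    moreover have "isCont f z"
      using f(1) by (auto simp: Hinf_def intro: holomorphic_on_imp_continuous_on
          continuous_on_interior[of UNIV])
    ultimately have lim: "(\<lambda>n. f (of_real (r n) * z)) \<longlonglongrightarrow> f z"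
      by (intro isCont_tendsto_compose[of z f]) (auto intro!: tendsto_eq_intros)
    have "cmod (f z * deriv g z) \<le> e / 2 * \<phi>' (cmod z)"
    proof (rule LIMSEQ_le_const2)
      show "(\<lambda>n. cmod (f (of_real (r n) * z) * deriv g z)) \<longlonglongrightarrow> cmod (f z * deriv g z)"
        by (intro tendsto_intros lim)
      have "cmod (f (of_real (r n) * z) * deriv g z) \<le> e / 2 * \<phi>' (cmod z)" for n
        by (rule D_small[OF z, of "\<lambda>z. f (of_real (r n) * z)"]) (use f r in \<open>auto simp: D_def\<close>)
      then show "\<exists>N. \<forall>n\<ge>N. cmod (f (of_real (r n) * z) * deriv g z) \<le> e / 2 * \<phi>' (cmod z)" by blast
    qed
    then have fg: "2 * (cmod (f z) * cmod (deriv g z)) \<le> e * \<phi>' (cmod z)" by (simp add: norm_mult)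
    have "cmod (deriv g z) * 1 \<le> cmod (deriv g z) * (2 * u' z * cmod (f z))"
      using f(3) by (intro mult_left_mono) auto
    also have "\<dots> = u' z * (2 * (cmod (f z) * cmod (deriv g z)))" by simp
    also have "\<dots> \<le> u' z * (e * \<phi>' (cmod z))"
      using fg assoc_weight_pos[of z] by (intro mult_left_mono) auto
    finally show ?thesis using assoc_weight_pos[of z] pos'[OF z(1)] by (simp add: field_simps)
  qed
  then show "\<exists>R. \<forall>z. R \<le> cmod z \<longrightarrow> symbol_quotient z \<le> e" by blast
qed

text \<open>The images of the dilates of \<open>f\<close> lie in the little-o space and converge pointwise to the image of
  \<open>f\<close>.  They have a weak cluster point, which equals this pointwise limit because evaluations are
  functionals; it lies in the little-o space because otherwise a generalised limit at infinity would
  separate it from the sequence.\<close>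

lemma volterra_Hinf_into_H0_if_weakly_compact:
  assumes T: "weakly_compact_operator X (wnorm u) Y (wnorm w) (volterra g)"
    and X: "H0 u \<subseteq> X" "X \<subseteq> Hinf u" and Y: "Y \<subseteq> Hinf w"
    and f: "f \<in> Hinf u"
  shows "volterra g f \<in> H0 w"
proof -
  have B: "bounded_operator X (wnorm u) Y (wnorm w) (volterra g)"
    using T by (simp add: weakly_compact_operator_def)
  have hol: "f holomorphic_on UNIV" using f by (simp add: Hinf_def)
  \<comment> \<open>Normalise \<open>f\<close>; adding \<open>1\<close> avoids a division by \<open>0\<close>.\<close>
  define k where "k = wnorm u f + 1"
  have k: "0 < k" "wnorm u f \<le> k" using wnorm_nonneg[OF f u_pos] by (auto simp: k_def)
  define h where "h z = of_real (1 / k) * f z" for z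
  have h: "h \<in> Hinf u" unfolding h_def by (rule Hinf_scale[OF f])
  have "wnorm u h \<le> 1 / k * wnorm u f"
    using wnorm_scale_le[OF f, of "of_real (1 / k)"] k by (simp add: h_def[abs_def] norm_divide)
  also have "\<dots> \<le> 1" using k by (simp add: field_simps)
  finally have h1: "wnorm u h \<le> 1" .
  define r where "r n = real (Suc n) / real (Suc (Suc n))" for n
  have r: "0 < r n" "r n < 1" for n by (auto simp: r_def)
  have r_lim: "r \<longlonglongrightarrow> 1" unfolding r_def by (rule LIMSEQ_Suc[OF LIMSEQ_n_over_Suc_n])
  let ?x = "\<lambda>n. volterra g (\<lambda>z. h (of_real (r n) * z))"
  have xH0: "?x n \<in> H0 w" for n by (rule volterra_dilation_in_H0[OF B X Y h r])
  have S: "relatively_compactin (weak_topology Y (wnorm w)) (volterra g ` {f \<in> X. wnorm u f \<le> 1})"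
    using T by (simp add: weakly_compact_operator_def)
  have xS: "?x n \<in> volterra g ` {f \<in> X. wnorm u f \<le> 1}" for n
  proof (intro imageI CollectI conjI)
    show "(\<lambda>z. h (of_real (r n) * z)) \<in> X" using dilation_in_H0[OF h r] X(1) by blast
    show "wnorm u (\<lambda>z. h (of_real (r n) * z)) \<le> 1"
      using dilation_in_Hinf(2)[OF h r, of n] h1 by linarith
  qed
  obtain F where F: "F \<in> Y"
    "\<And>\<psi> L. \<psi> \<in> dual_space Y (wnorm w) \<Longrightarrow> (\<lambda>n. \<psi> (?x n)) \<longlonglongrightarrow> L \<Longrightarrow> \<psi> F = L"
    using weak_cluster_point[where x = ?x, OF S xS] by metis
  have hol_h: "h holomorphic_on UNIV" using h by (simp add: Hinf_def)
  have "F z = volterra g h z" for z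
    by (rule F(2)[OF evaluation_in_dual_space[OF Y w_pos]
          volterra_dilations_converge[OF hol_h g r r_lim]])
  then have Fh: "F = volterra g h" by (rule ext)
  have FH0: "F \<in> H0 w"
  proof (rule ccontr)
    assume nF: "F \<notin> H0 w"
    have F_in: "F \<in> Hinf w" using F(1) Y by blast
    obtain \<psi> where \<psi>: "\<psi> \<in> dual_space (Hinf w) (wnorm w)" "\<And>G. G \<in> H0 w \<Longrightarrow> \<psi> G = 0" "\<psi> F \<noteq> 0"
      using generalised_limit_at_infinity[of w F, OF w_pos F_in nF] by metis
    have "\<psi> \<in> dual_space Y (wnorm w)"
      using \<psi>(1) by (rule subsetD[OF dual_space_antimono[OF Y]])
    then have "\<psi> F = 0" by (rule F(2)) (simp add: \<psi>(2)[OF xH0])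
    then show False using \<psi>(3) by simp
  qed
  have "volterra g f = (\<lambda>z. of_real k * volterra g h z)"
  proof -
    have "f = (\<lambda>z. of_real k * h z)" using k by (simp add: h_def fun_eq_iff)
    then show ?thesis using volterra_scale[OF hol_h g, of "of_real k"] by simp
  qed
  then show ?thesis using H0_scale[OF FH0, of "of_real k"] Fh by simp
qed

text \<open>If the symbol quotient stays away from \<open>0\<close> along a sequence tending to infinity, interpolate the extremal
  values \<open>1 / u'\<close> on a subsequence by a function \<open>f\<close>.  Since \<open>u \<le> u'\<close>, this \<open>f\<close> belongs to the big-O
  space of \<open>u\<close>, so its image is in the little-o space of the target.  Then \<open>f * g' / \<phi>'\<close> tends to \<open>0\<close>,
  but on the subsequence its modulus is exactly the symbol quotient.\<close>

lemma symbol_small_if_weakly_compact_operator: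
  assumes T: "weakly_compact_operator X (wnorm u) Y (wnorm w) (volterra g)"
    and X: "H0 u \<subseteq> X" "X \<subseteq> Hinf u" and Y: "Y \<subseteq> Hinf w"
    and interpol: "\<And>z. filterlim z at_infinity sequentially \<Longrightarrow>
      \<exists>s::nat \<Rightarrow> nat. strict_mono s \<and> interpolating u' (z \<circ> s)"
  shows "(symbol_quotient \<longlongrightarrow> 0) at_infinity"
proof (rule ccontr)
  assume "\<not> ?thesis"
  then obtain c where c: "0 < c" "\<And>R. \<exists>z. R \<le> cmod z \<and> c < symbol_quotient z"
    unfolding tendsto_0_at_infinity_iff[OF symbol_quotient_nonneg] by (meson linorder_not_le)
  then have "\<forall>n::nat. \<exists>z. real n \<le> cmod z \<and> c < symbol_quotient z" by blast
  then obtain z where z: "\<And>n::nat. real n \<le> cmod (z n)" "\<And>n. c < symbol_quotient (z n)" by metis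
  have "filterlim (\<lambda>n. cmod (z n)) at_top sequentially"
    by (rule filterlim_at_top_mono[OF filterlim_real_sequentially]) (simp add: z(1))
  then have zlim: "filterlim z at_infinity sequentially" by (simp add: filterlim_at_infinity_conv_norm_at_top)
  then obtain s where s: "strict_mono s" "interpolating u' (z \<circ> s)" using interpol by blast
  define \<alpha> where "\<alpha> j = complex_of_real (inverse (u' (z (s j))))" for j
  have \<alpha>: "u' (z (s j)) * cmod (\<alpha> j) = 1" for j
    using assoc_weight_pos[of "z (s j)"] by (simp add: \<alpha>_def norm_inverse)
  then have "bdd_above (range (\<lambda>j. u' ((z \<circ> s) j) * cmod (\<alpha> j)))" by simp
  then obtain f where f: "f \<in> Hinf u'" "\<And>j. f (z (s j)) = \<alpha> j"
    using s(2) unfolding interpolating_def o_def by blast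
  have fu: "f \<in> Hinf u"
  proof -
    have "u \<zeta> * cmod (f \<zeta>) \<le> wnorm u' f" for \<zeta>
      using mult_right_mono[OF le_assoc_weight[of \<zeta>] norm_ge_zero[of "f \<zeta>"]] le_wnorm[OF f(1), of \<zeta>]
      by linarith
    then show ?thesis using f(1) by (auto simp: Hinf_iff_bounded)
  qed
  have hol: "f holomorphic_on UNIV" using fu by (simp add: Hinf_def)
  have "((\<lambda>\<zeta>. cmod (deriv (volterra g f) \<zeta>) / \<phi>' (cmod \<zeta>)) \<longlongrightarrow> 0) at_infinity"
    by (intro deriv_small_if_H0 volterra_Hinf_into_H0_if_weakly_compact[OF T X Y fu])
  moreover have "filterlim (\<lambda>j. z (s j)) at_infinity sequentially"
    using filterlim_compose[OF zlim filterlim_subseq[OF s(1)]] by (simp add: o_def)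
  ultimately have "(\<lambda>j. cmod (deriv (volterra g f) (z (s j))) / \<phi>' (cmod (z (s j)))) \<longlonglongrightarrow> 0"
    by (rule filterlim_compose)
  moreover have "cmod (deriv (volterra g f) (z (s j))) / \<phi>' (cmod (z (s j))) = symbol_quotient (z (s j))" for j
    using assoc_weight_pos[of "z (s j)"]
    by (simp add: deriv_volterra[OF hol g] f(2) \<alpha>_def norm_mult norm_inverse divide_inverse)
  ultimately have "(\<lambda>j. symbol_quotient (z (s j))) \<longlonglongrightarrow> 0" by simp
  then have "c \<le> 0" by (rule LIMSEQ_le_const) (simp add: z(2) less_imp_le)
  then show False using c(1) by simp
qed

end

section \<open>The equivalences\<close>

theorem theorem3p5:
  fixes v \<phi> \<phi>' \<phi>'' :: "real \<Rightarrow> real" and r\<^sub>\<phi> :: real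
    and w :: "complex \<Rightarrow> real" and g :: "complex \<Rightarrow> complex"
  assumes v: "is_weight v"
    and \<phi>_cont: "continuous_on {0..} \<phi>"
    and \<phi>_mono: "mono_on {0..} \<phi>"
    and \<phi>_pos: "\<And>r. r \<ge> 0 \<Longrightarrow> \<phi> r > 0"
    and r\<phi>_pos: "r\<^sub>\<phi> > 0"
    and \<phi>_deriv: "\<And>r. r \<ge> r\<^sub>\<phi> \<Longrightarrow> (\<phi> has_real_derivative \<phi>' r) (at r within {r\<^sub>\<phi>..})"
    and \<phi>'_deriv: "\<And>r. r \<ge> r\<^sub>\<phi> \<Longrightarrow> (\<phi>' has_real_derivative \<phi>'' r) (at r within {r\<^sub>\<phi>..})"
    and \<phi>''_cont: "continuous_on {r\<^sub>\<phi>..} \<phi>''"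
    and \<phi>'_mono: "mono_on {r\<^sub>\<phi>..} \<phi>'"
    and \<phi>'_pos: "\<phi>' r\<^sub>\<phi> > 0"
    and \<phi>'_growth: "\<And>n::nat. (\<lambda>r. r ^ n) \<in> O[at_top](\<phi>')"
    and \<phi>''_bound: "bdd_above ((\<lambda>r. \<phi>'' r * \<phi> r / (\<phi>' r)\<^sup>2) ` {r\<^sub>\<phi>..})"
    and w_def: "w = (\<lambda>z. 1 / \<phi> (cmod z))"
    and g: "g holomorphic_on UNIV"
  defines "C1 \<equiv> compact_operator (Hinf (radial v)) (wnorm (radial v)) (Hinf w) (wnorm w) (volterra g)"
    and "C2 \<equiv> compact_operator (H0 (radial v)) (wnorm (radial v)) (H0 w) (wnorm w) (volterra g)"
    and "C3 \<equiv> ((\<lambda>z. cmod (deriv g z) / (\<phi>' (cmod z) * assoc_weight (radial v) z)) \<longlongrightarrow> 0) at_infinity"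
    and "C4 \<equiv> weakly_compact_operator (Hinf (radial v)) (wnorm (radial v)) (Hinf w) (wnorm w) (volterra g)"
    and "C5 \<equiv> weakly_compact_operator (H0 (radial v)) (wnorm (radial v)) (H0 w) (wnorm w) (volterra g)"
  shows "(C1 \<longleftrightarrow> C2) \<and> (C2 \<longleftrightarrow> C3) \<and>
         ((\<forall>z::nat \<Rightarrow> complex. filterlim z at_infinity sequentially \<longrightarrow>
              (\<exists>s::nat \<Rightarrow> nat. strict_mono s \<and> interpolating (assoc_weight (radial v)) (z \<circ> s)))
          \<longrightarrow> (C3 \<longleftrightarrow> C4) \<and> (C4 \<longleftrightarrow> C5))"
proof -
  interpret V: volterra_setting \<phi> \<phi>' \<phi>'' r\<^sub>\<phi> v g
    by unfold_locales (fact \<phi>_cont \<phi>_mono \<phi>_pos r\<phi>_pos \<phi>_deriv \<phi>'_deriv \<phi>'_mono \<phi>'_pos \<phi>''_bound v g)+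
  have w: "w = V.w"
    unfolding w_def by (simp add: fun_eq_iff V.w_def)
  have subset: "H0 w \<subseteq> Hinf w"
    unfolding w by (rule H0_subset_Hinf[OF V.w_pos V.continuous_w])
  note sources = V.H0_subset_Hinf_u and targets = subset[unfolded w]
  have C31: C1 if C3
    using that unfolding C1_def C3_def w
    by (rule V.compact_operator_if_symbol_small) (simp_all add: targets)
  have C32: C2 if C3
    using that unfolding C2_def C3_def w
    by (rule V.compact_operator_if_symbol_small) (simp_all add: sources targets)
  have C13: C3 if C1
    using that unfolding C1_def C3_def w
    by (rule V.symbol_small_if_compact_operator) (simp_all add: sources)
  have C23: C3 if C2
    using that unfolding C2_def C3_def w
    by (rule V.symbol_small_if_compact_operator) (simp_all add: sources targets)
  have C14: C4 if C1
    using that unfolding C1_def C4_def w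
    by (intro compact_operator_imp_weakly_compact_operator V.w_pos Hinf_diff) auto
  have C25: C5 if C2
    using that unfolding C2_def C5_def w
    by (intro compact_operator_imp_weakly_compact_operator V.w_pos H0_diff targets) auto
  have C43: C3 if C4 and "\<And>z. filterlim z at_infinity sequentially \<Longrightarrow>
      \<exists>s::nat \<Rightarrow> nat. strict_mono s \<and> interpolating (assoc_weight (radial v)) (z \<circ> s)"
    using that unfolding C4_def C3_def w
    by (intro V.symbol_small_if_weakly_compact_operator[OF _ sources order_refl order_refl]) auto
  have C53: C3 if C5 and "\<And>z. filterlim z at_infinity sequentially \<Longrightarrow>
      \<exists>s::nat \<Rightarrow> nat. strict_mono s \<and> interpolating (assoc_weight (radial v)) (z \<circ> s)"
    using that unfolding C5_def C3_def w
    by (intro V.symbol_small_if_weakly_compact_operator[OF _ order_refl sources targets]) auto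
  show ?thesis
    using C31 C32 C13 C23 C14 C25 C43 C53 by blast
qed

end
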